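(* Let $Z$ be a polygon chain with $n$ faces and type $t(s_1,* )M_2\cdots M_{n-1}t(s_n,* )$, where for $i\in\{2,\dots,n-1\}$, $M_i\in\{t(s_i,1),t(s_i,2),\dots,t(s_i,s_i-3)\}$. Then $$\Psi(Z)=X\times T_{s_1,1}\times\prod_{i=2}^{n-1}f(M_i)\times T_{s_n,1}\times Y,$$ where $f(t(s_i,j))=T_{s_i,j}$ for $j\in\{1,\dots,s_i-3\}$, $X=(1,0,0,0,0,0,0,0,0)$ and $Y=(1,1,1,1,1,0,0,1,1)^T$.
   Context: A matching is maximal if it is not contained in a larger matching; $\Psi(Z)$ is the number of maximal matchings of $Z$. A polygon chain with $n\ge2$ faces is a 2-connected plane graph consisting of cycles (faces) $p_1,\dots,p_n$, $p_j$ of length $s_j\ge4$, where $p_{j-1}$ and $p_j$ share exactly one edge $e_j$ ($j=2,\dots,n$), no other pairs share edges, and each vertex lies on at most two faces. In a fixed planar embedding, for $j\in[2,n-1]$, $k_j\in[1,s_j-3]$ is the number of edges of $p_j$ strictly between $e_j$ and $e_{j+1}$ when $p_j$ is traversed clockwise starting from $e_j$; the type is $t(s_1,* )t(s_2,k_2)\cdots t(s_{n-1},k_{n-1})t(s_n,* )$. Definition of the $9\times9$ matrix $T_{m,i}$ ($m\ge4$, $1\le i\le m-3$). Let $J$ be a cycle with vertices $v_0,\dots,v_{m-1}$ in cyclic order, $b=v_0$, $a=v_1$, $d=v_{i+1}$, $c=v_{i+2}$, $e=v_i$, $f=v_{i+3}$ with $v_m=v_0$. Let $J'$ be obtained from $J$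 by deleting edge $dc$ and adding new vertices $k_1,k_2$ with edges $k_1d$, $k_2c$. For $x=1,\dots,9$: $\mathcal W_1$= maximal matchings of $J'$, $R_1=\emptyset$; $\mathcal W_2$= maximal matchings of $J'-a$, $R_2=\{a\}$; $\mathcal W_3$= of $J'-b$, $R_3=\{b\}$; $\mathcal W_4$= of $J'-a-b$, $R_4=\{a,b\}$; $\mathcal W_5$= maximal matchings of $J'$ covering $a$ and $b$, $R_5=\emptyset$; $\mathcal W_6$= of $J'-a$ covering $b$, $R_6=\{a\}$; $\mathcal W_7$= of $J'-b$ covering $a$, $R_7=\{b\}$; $\mathcal W_8$= of $J'$ covering $a$, $R_8=\emptyset$; $\mathcal W_9$= of $J'$ covering $b$, $R_9=\emptyset$. For $W\in\mathcal W_x$ let $V'$ = (vertices covered by $W$) $\cup R_x$, and assign $W$ the first $y\in\{1,\dots,9\}$ whose condition holds: $y=1$: $k_1,e,k_2,f\in V'$; $y=2$: $k_2,f\in V'$, $k_1\notin V'$; $y=3$: $k_1,e\in V'$, $k_2\notin V'$; $y=4$: $k_1,k_2\notin V'$; $y=5$: $e,f\notin V'$; $y=6$: $k_1,f\notin V'$; $y=7$: $k_2,e\notin V'$; $y=8$: $k_2,f\in V'$, $e\notin V'$; $y=9$: $k_1,e\in V'$, $f\notin V'$. Then $T_{m,i}[x,y]$ is the number of $W\in\mathcal W_x$ assigned $y$. *)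

theory Defs
  imports "HOL-Complex_Analysis.Winding_Numbers" "Jordan_Normal_Form.Matrix"
begin

section \<open>Maximal matchings\<close>

text \<open>A finite simple graph is a vertex set \<open>V\<close> together with a set \<open>E\<close> of two-element subsets
  of \<open>V\<close>.  Matchings do not see isolated vertices, so the notions below only mention \<open>E\<close>.\<close>

definition matching :: "'a set set \<Rightarrow> 'a set set \<Rightarrow> bool" where
  "matching E M \<longleftrightarrow> M \<subseteq> E \<and> pairwise disjnt M"

definition maximal_matching :: "'a set set \<Rightarrow> 'a set set \<Rightarrow> bool" where
  "maximal_matching E M \<longleftrightarrow> matching E M \<and> \<not> (\<exists>M'. matching E M' \<and> M \<subset> M')"

definition num_maximal_matchings :: "'a set set \<Rightarrow> nat" where
  "num_maximal_matchings E = card {M. maximal_matching E M}"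

definition delete_vertices :: "'a set set \<Rightarrow> 'a set \<Rightarrow> 'a set set" where
  "delete_vertices E S = {e \<in> E. e \<inter> S = {}}"

section \<open>Graphs, plane graphs and cycles\<close>

definition simple_graph :: "'a set \<Rightarrow> 'a set set \<Rightarrow> bool" where
  "simple_graph V E \<longleftrightarrow> finite V \<and> (\<forall>e\<in>E. e \<subseteq> V \<and> card e = 2)"

definition connected_graph :: "'a set \<Rightarrow> 'a set set \<Rightarrow> bool" where
  "connected_graph V E \<longleftrightarrow> (\<forall>u\<in>V. \<forall>v\<in>V. (u, v) \<in> {(x, y). {x, y} \<in> E}\<^sup>*)"

definition two_connected :: "'a set \<Rightarrow> 'a set set \<Rightarrow> bool" where
  "two_connected V E \<longleftrightarrow> card V > 2 \<and> connected_graph V E \<and>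
     (\<forall>x\<in>V. connected_graph (V - {x}) (delete_vertices E {x}))"

text \<open>The vertices of a plane graph are points of the plane, and \<open>\<gamma> u v\<close> is the arc drawn for the
  edge \<open>{u, v}\<close>, parametrised from \<open>u\<close> to \<open>v\<close>.  Values of \<open>\<gamma>\<close> at non-edges are irrelevant.\<close>

definition plane_graph ::
    "complex set \<Rightarrow> complex set set \<Rightarrow> (complex \<Rightarrow> complex \<Rightarrow> real \<Rightarrow> complex) \<Rightarrow> bool" where
  "plane_graph V E \<gamma> \<longleftrightarrow> simple_graph V E \<and>
     (\<forall>u v. {u, v} \<in> E \<longrightarrow>
        arc (\<gamma> u v) \<and> pathstart (\<gamma> u v) = u \<and> pathfinish (\<gamma> u v) = v \<and>
        \<gamma> v u = reversepath (\<gamma> u v) \<and> path_image (\<gamma> u v) \<inter> V = {u, v}) \<and>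
     (\<forall>u v x y. {u, v} \<in> E \<longrightarrow> {x, y} \<in> E \<longrightarrow> {u, v} \<noteq> {x, y} \<longrightarrow>
        path_image (\<gamma> u v) \<inter> path_image (\<gamma> x y) \<subseteq> V)"

definition drawing ::
    "complex set \<Rightarrow> complex set set \<Rightarrow> (complex \<Rightarrow> complex \<Rightarrow> real \<Rightarrow> complex) \<Rightarrow> complex set" where
  "drawing V E \<gamma> = V \<union> \<Union> {path_image (\<gamma> u v) | u v. {u, v} \<in> E}"

definition plane_faces ::
    "complex set \<Rightarrow> complex set set \<Rightarrow> (complex \<Rightarrow> complex \<Rightarrow> real \<Rightarrow> complex) \<Rightarrow> complex set set" where
  "plane_faces V E \<gamma> = components (- drawing V E \<gamma>)"

text \<open>A cycle is given by the list of its vertices in cyclic order; \<open>cyc_edge p a\<close> is its \<open>a\<close>-th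
  edge.\<close>

definition cyc_edge :: "'a list \<Rightarrow> nat \<Rightarrow> 'a set" where
  "cyc_edge p a = {p ! a, p ! (Suc a mod length p)}"

definition cyc_edges :: "'a list \<Rightarrow> 'a set set" where
  "cyc_edges p = cyc_edge p ` {..<length p}"

fun walk_path ::
    "(complex \<Rightarrow> complex \<Rightarrow> real \<Rightarrow> complex) \<Rightarrow> complex list \<Rightarrow> real \<Rightarrow> complex" where
  "walk_path \<gamma> [] = linepath 0 0"
| "walk_path \<gamma> [u] = linepath u u"
| "walk_path \<gamma> [u, v] = \<gamma> u v"
| "walk_path \<gamma> (u # v # w # ws) = \<gamma> u v +++ walk_path \<gamma> (v # w # ws)"

definition cycle_path ::
    "(complex \<Rightarrow> complex \<Rightarrow> real \<Rightarrow> complex) \<Rightarrow> complex list \<Rightarrow> real \<Rightarrow> complex" where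
  "cycle_path \<gamma> p = walk_path \<gamma> (p @ [hd p])"

definition cycle_interior ::
    "(complex \<Rightarrow> complex \<Rightarrow> real \<Rightarrow> complex) \<Rightarrow> complex list \<Rightarrow> complex set" where
  "cycle_interior \<gamma> p = inside (path_image (cycle_path \<gamma> p))"

definition clockwise ::
    "(complex \<Rightarrow> complex \<Rightarrow> real \<Rightarrow> complex) \<Rightarrow> complex list \<Rightarrow> bool" where
  "clockwise \<gamma> p \<longleftrightarrow> (\<forall>z \<in> cycle_interior \<gamma> p. winding_number (cycle_path \<gamma> p) z = - 1)"

section \<open>Polygon chains and their types\<close>

text \<open>The list \<open>ps\<close> holds the faces \<open>p\<^sub>1, \<dots>, p\<^sub>n\<close> (so \<open>p\<^sub>j\<close> is \<open>ps ! (j - 1)\<close>), each listed clockwise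
  in the given drawing.  They are all the bounded faces of the plane graph.\<close>

definition polygon_chain ::
    "complex set \<Rightarrow> complex set set \<Rightarrow> (complex \<Rightarrow> complex \<Rightarrow> real \<Rightarrow> complex) \<Rightarrow>
       complex list list \<Rightarrow> bool" where
  "polygon_chain V E \<gamma> ps \<longleftrightarrow>
     2 \<le> length ps \<and>
     plane_graph V E \<gamma> \<and> two_connected V E \<and>
     (\<forall>p \<in> set ps. distinct p \<and> 4 \<le> length p \<and> clockwise \<gamma> p) \<and>
     V = (\<Union>p \<in> set ps. set p) \<and> E = (\<Union>p \<in> set ps. cyc_edges p) \<and>
     {F \<in> plane_faces V E \<gamma>. bounded F} = cycle_interior \<gamma> ` set ps \<and>
     (\<forall>j. Suc j < length ps \<longrightarrow> card (cyc_edges (ps ! j) \<inter> cyc_edges (ps ! Suc j)) = 1) \<and>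
     (\<forall>i j. Suc i < j \<and> j < length ps \<longrightarrow> cyc_edges (ps ! i) \<inter> cyc_edges (ps ! j) = {}) \<and>
     (\<forall>v \<in> V. card {j. j < length ps \<and> v \<in> set (ps ! j)} \<le> 2)"

definition shared_edge :: "'a list \<Rightarrow> 'a list \<Rightarrow> 'a set" where
  "shared_edge p q = (THE e. e \<in> cyc_edges p \<inter> cyc_edges q)"

text \<open>The number of edges of the cycle \<open>p\<close> strictly between \<open>e\<close> and \<open>e'\<close> when \<open>p\<close> is traversed in
  list order starting from \<open>e\<close>.\<close>

definition edges_between :: "'a list \<Rightarrow> 'a set \<Rightarrow> 'a set \<Rightarrow> nat" where
  "edges_between p e e' = (THE k. k < length p \<and>
     (\<exists>a < length p. cyc_edge p a = e \<and> cyc_edge p ((a + k + 1) mod length p) = e'))"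

text \<open>\<open>Terminal s\<close> stands for \<open>t(s,*)\<close> and \<open>Internal s k\<close> for \<open>t(s,k)\<close>.\<close>

datatype polygon_type = Terminal nat | Internal nat nat

definition chain_type :: "'a list list \<Rightarrow> polygon_type list" where
  "chain_type ps = map (\<lambda>j.
     if j = 0 \<or> Suc j = length ps then Terminal (length (ps ! j))
     else Internal (length (ps ! j))
       (edges_between (ps ! j)
         (shared_edge (ps ! (j - 1)) (ps ! j)) (shared_edge (ps ! j) (ps ! Suc j))))
     [0..<length ps]"

section \<open>The transfer matrices\<close>

datatype jvertex = Vx nat | K1 | K2

definition Jprime :: "nat \<Rightarrow> nat \<Rightarrow> jvertex set set" where
  "Jprime m i =
     ({{Vx j, Vx (Suc j mod m)} | j. j < m} - {{Vx (i + 1), Vx (i + 2)}}) \<union>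
     {{K1, Vx (i + 1)}, {K2, Vx (i + 2)}}"

text \<open>Rows and columns \<open>1, \<dots>, 9\<close> are indexed \<open>0, \<dots>, 8\<close>.  Recall \<open>b = Vx 0\<close> and \<open>a = Vx 1\<close>.\<close>

definition row_removed :: "nat \<Rightarrow> jvertex set" where
  "row_removed x =
     (let b = Vx 0; a = Vx 1 in [{}, {a}, {b}, {a, b}, {}, {a}, {b}, {}, {}] ! x)"

definition row_required :: "nat \<Rightarrow> jvertex set" where
  "row_required x =
     (let b = Vx 0; a = Vx 1 in [{}, {}, {}, {}, {a, b}, {b}, {a}, {a}, {b}] ! x)"

definition row_matchings :: "nat \<Rightarrow> nat \<Rightarrow> nat \<Rightarrow> jvertex set set set" where
  "row_matchings m i x =
     {W. maximal_matching (delete_vertices (Jprime m i) (row_removed x)) W \<and>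
         row_required x \<subseteq> \<Union>W}"

definition column_condition :: "nat \<Rightarrow> nat \<Rightarrow> jvertex set \<Rightarrow> nat \<Rightarrow> bool" where
  "column_condition m i U y =
     (let e = Vx i; f = Vx ((i + 3) mod m) in
      [K1 \<in> U \<and> e \<in> U \<and> K2 \<in> U \<and> f \<in> U,
       K2 \<in> U \<and> f \<in> U \<and> K1 \<notin> U,
       K1 \<in> U \<and> e \<in> U \<and> K2 \<notin> U,
       K1 \<notin> U \<and> K2 \<notin> U,
       e \<notin> U \<and> f \<notin> U,
       K1 \<notin> U \<and> f \<notin> U,
       K2 \<notin> U \<and> e \<notin> U,
       K2 \<in> U \<and> f \<in> U \<and> e \<notin> U,
       K1 \<in> U \<and> e \<in> U \<and> f \<notin> U] ! y)"

definition assigned :: "nat \<Rightarrow> nat \<Rightarrow> jvertex set \<Rightarrow> nat \<Rightarrow> bool" where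
  "assigned m i U y \<longleftrightarrow>
     column_condition m i U y \<and> (\<forall>y' < y. \<not> column_condition m i U y')"

definition T_mat :: "nat \<Rightarrow> nat \<Rightarrow> nat mat" where
  "T_mat m i = Matrix.mat 9 9 (\<lambda>(x, y).
     card {W \<in> row_matchings m i x. assigned m i (\<Union>W \<union> row_removed x) y})"

text \<open>The map \<open>f\<close>; it is left unspecified on \<open>t(s,*)\<close>.\<close>

fun f_mat :: "polygon_type \<Rightarrow> nat mat" where
  "f_mat (Internal s j) = T_mat s j"

definition X_mat :: "nat mat" where
  "X_mat = mat_of_rows_list 9 [[1, 0, 0, 0, 0, 0, 0, 0, 0]]"

definition Y_mat :: "nat mat" where
  "Y_mat = transpose_mat (mat_of_rows_list 9 [[1, 1, 1, 1, 1, 0, 0, 1, 1]])"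

definition mat9_prod_list :: "nat mat list \<Rightarrow> nat mat" where
  "mat9_prod_list As = foldr (*) As (1\<^sub>m 9)"

end

theory Submission
  imports Defs "HOL-Analysis.Jordan_Curve" "HOL-Number_Theory.Cong"
begin

text \<open>
  Cut the chain at the shared edge \<open>dc\<close> of a face \<open>J\<close> and the rest \<open>H\<close> of the chain behind it.  A maximal
  matching restricts to a matching \<open>L\<close> of the path \<open>J - dc\<close> and a matching of \<open>H\<close>, and all that \<open>H\<close> sees of
  \<open>L\<close> is, for each of \<open>d\<close> and \<open>c\<close>, whether it is already covered, must still be covered (its neighbour on
  the path being uncovered), or is free.  These are \<open>3 \<times> 3 = 9\<close> states, one for each row.  The same
  decomposition with \<open>H\<close> replaced by the two pendant edges at \<open>k\<^sub>1, k\<^sub>2\<close> shows that the matrix \<open>T\<close> counts the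
  matchings \<open>L\<close> by state.  Hence the vector of row counts of \<open>J \<union> H\<close> is \<open>T\<close> times that of \<open>H\<close>, and \<open>Y\<close> is
  the vector of a single edge.

  The plane embedding is needed for two facts: adjacent faces traverse their common edge in opposite
  directions, and two faces meet only in a common edge.  Both follow from one observation: an integral
  combination of winding numbers of closed walks in which an edge cancels is constant near an inner
  point of that edge, whereas the winding number of a clockwise face jumps there from \<open>0\<close> to \<open>-1\<close>.
  Two faces traversing an edge in the same direction contradict this at once.  It also implies that
  every closed walk is, as a 1-chain, a combination of the faces, so the flow of a closed walk through a
  vertex \<open>v\<close> is balanced inside each face whose edges at \<open>v\<close> lie on no other face; if two faces touched
  only in \<open>v\<close>, 2-connectedness would give a closed walk through \<open>v\<close> from one face to the other.
\<close>

section \<open>Walks as chains of edges\<close>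

definition steps :: "'a list \<Rightarrow> ('a \<times> 'a) list" where
  "steps xs = zip xs (tl xs)"

text \<open>The coefficient of the oriented edge \<open>(u, v)\<close> in the 1-chain of a walk.\<close>

definition net :: "'a \<Rightarrow> 'a \<Rightarrow> 'a list \<Rightarrow> int" where
  "net u v xs = int (count_list (steps xs) (u, v)) - int (count_list (steps xs) (v, u))"

lemma steps_simps [simp]:
  "steps [] = []" "steps [x] = []" "steps (x # y # xs) = (x, y) # steps (y # xs)"
  by (auto simp: steps_def)

lemma steps_append: "xs \<noteq> [] \<Longrightarrow> ys \<noteq> [] \<Longrightarrow>
    steps (xs @ ys) = steps xs @ (last xs, hd ys) # steps ys"
proof (induction xs rule: induct_list012)
  case (2 x)
  then show ?case by (cases ys) auto
qed auto

lemma successively_iff_steps: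
  "successively P xs \<longleftrightarrow> (\<forall>(u, v) \<in> set (steps xs). P u v)"
  by (induction xs rule: induct_list012) auto

lemma steps_subset: "(u, v) \<in> set (steps xs) \<Longrightarrow> u \<in> set xs \<and> v \<in> set xs"
  by (induction xs rule: induct_list012) auto

lemma steps_conv_nth: "steps xs = map (\<lambda>a. (xs ! a, xs ! Suc a)) [0..<length xs - 1]"
  by (rule nth_equalityI) (auto simp: steps_def nth_tl)

lemma steps_closed:
  assumes "p \<noteq> []"
  shows "steps (p @ [hd p]) = map (\<lambda>a. (p ! a, p ! (Suc a mod length p))) [0..<length p]"
  unfolding steps_conv_nth
  using assms by (auto simp: nth_append hd_conv_nth mod_Suc intro!: map_cong)

lemma cyc_edges_steps:
  assumes "p \<noteq> []"
  shows "cyc_edges p = (\<lambda>(u, v). {u, v}) ` set (steps (p @ [hd p]))"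
  unfolding steps_closed[OF assms] cyc_edges_def cyc_edge_def by (auto simp: image_image)

lemma distinct_steps_closed: "distinct p \<Longrightarrow> p \<noteq> [] \<Longrightarrow> distinct (steps (p @ [hd p]))"
  by (auto simp: steps_closed distinct_map inj_on_def nth_eq_iff_index_eq)

text \<open>Two steps that reverse each other would sit at positions each of which is the cyclic
  successor of the other; this forces a cycle of length at most two.\<close>

lemma steps_closed_asym:
  assumes "distinct p" "3 \<le> length p" "(u, v) \<in> set (steps (p @ [hd p]))"
  shows "(v, u) \<notin> set (steps (p @ [hd p]))"
proof
  assume "(v, u) \<in> set (steps (p @ [hd p]))"
  moreover have ne: "p \<noteq> []" using assms(2) by auto
  ultimately obtain a b where ab: "a < length p" "b < length p" "u = p ! a" "v = p ! (Suc a mod length p)"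
    "v = p ! b" "u = p ! (Suc b mod length p)"
    using assms(3) unfolding steps_closed[OF ne] by auto
  then have "b = Suc a mod length p" "a = Suc b mod length p"
    using assms(1) ne nth_eq_iff_index_eq[OF assms(1)] by (metis length_greater_0_conv mod_less_divisor)+
  then show False
    using assms(2) ab(1,2) by (auto simp: mod_Suc split: if_splits)
qed

lemma count_list_distinct: "distinct xs \<Longrightarrow> x \<in> set xs \<Longrightarrow> count_list xs x = 1"
  by (induction xs) (auto simp: count_list_0_iff)

text \<open>Going round a cycle passes each edge once, and by \<open>steps_closed_asym\<close> in
  one direction only.\<close>

lemma net_closed:
  assumes "distinct p" "3 \<le> length p" "(u, v) \<in> set (steps (p @ [hd p]))"
  shows "net u v (p @ [hd p]) = 1"
proof -
  have "p \<noteq> []" using assms(2) by auto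
  then show ?thesis
    using steps_closed_asym[OF assms] assms distinct_steps_closed[of p]
    by (simp add: net_def count_list_0_iff count_list_distinct)
qed

lemma net_eq_0:
  assumes "(u, v) \<notin> set (steps xs)" "(v, u) \<notin> set (steps xs)"
  shows "net u v xs = 0"
  using assms by (simp add: net_def count_list_0_iff)

lemma net_swap: "net v u xs = - net u v xs"
  by (simp add: net_def)

section \<open>Winding numbers of walks in a plane graph\<close>

locale drawn_graph =
  fixes V :: "complex set" and E :: "complex set set"
    and \<gamma> :: "complex \<Rightarrow> complex \<Rightarrow> real \<Rightarrow> complex"
  assumes plane: "plane_graph V E \<gamma>"
begin

abbreviation walk :: "complex list \<Rightarrow> bool" where
  "walk xs \<equiv> 2 \<le> length xs \<and> successively (\<lambda>u v. {u, v} \<in> E) xs"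

lemma edge_arc:
  assumes "{u, v} \<in> E"
  shows "arc (\<gamma> u v)" "path (\<gamma> u v)" "pathstart (\<gamma> u v) = u" "pathfinish (\<gamma> u v) = v"
    "\<gamma> v u = reversepath (\<gamma> u v)" "path_image (\<gamma> u v) \<inter> V = {u, v}"
    "path_image (\<gamma> v u) = path_image (\<gamma> u v)"
proof -
  have *: "arc (\<gamma> u v)" "pathstart (\<gamma> u v) = u" "pathfinish (\<gamma> u v) = v"
    "\<gamma> v u = reversepath (\<gamma> u v)" "path_image (\<gamma> u v) \<inter> V = {u, v}"
    using plane assms unfolding plane_graph_def by blast+
  from * show "arc (\<gamma> u v)" "pathstart (\<gamma> u v) = u" "pathfinish (\<gamma> u v) = v"
    "\<gamma> v u = reversepath (\<gamma> u v)" "path_image (\<gamma> u v) \<inter> V = {u, v}"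
    by blast+
  show "path (\<gamma> u v)" using * arc_imp_path by blast
  show "path_image (\<gamma> v u) = path_image (\<gamma> u v)" using * by simp
qed

lemma simple: "simple_graph V E"
  using plane unfolding plane_graph_def by (rule conjunct1)

lemma edge_neq:
  assumes "{u, v} \<in> E"
  shows "u \<noteq> v"
proof -
  have "card {u, v} = 2" using simple assms unfolding simple_graph_def by metis
  then show ?thesis by auto
qed

lemma edge_subset: "{u, v} \<in> E \<Longrightarrow> u \<in> V \<and> v \<in> V"
  using simple unfolding simple_graph_def by (metis insert_subset)

text \<open>Different edges of a plane graph meet only in vertices, and an arc contains no vertices
  besides its two ends.\<close>

lemma edges_meet:
  "{u, v} \<in> E \<Longrightarrow> {x, y} \<in> E \<Longrightarrow> {u, v} \<noteq> {x, y} \<Longrightarrow>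
    path_image (\<gamma> u v) \<inter> path_image (\<gamma> x y) \<subseteq> {u, v} \<inter> {x, y}"
  using plane[unfolded plane_graph_def, THEN conjunct2, THEN conjunct2, rule_format, of u v x y]
    edge_arc(6)[of u v] edge_arc(6)[of x y] by blast

lemma walk_path_basic:
  assumes "walk xs"
  shows "path (walk_path \<gamma> xs) \<and> pathstart (walk_path \<gamma> xs) = hd xs \<and>
     pathfinish (walk_path \<gamma> xs) = last xs \<and>
     path_image (walk_path \<gamma> xs) = (\<Union>(u, v) \<in> set (steps xs). path_image (\<gamma> u v))"
  using assms
proof (induction xs rule: induct_list012)
  case (3 u v zs)
  then show ?case using edge_arc[of u v] by (cases zs) (auto simp: path_image_join)
qed auto

lemma walk_path_image_subset:
  assumes "walk xs"
  shows "path_image (walk_path \<gamma> xs) \<subseteq> drawing V E \<gamma>"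
proof -
  have "path_image (\<gamma> u v) \<subseteq> drawing V E \<gamma>" if "(u, v) \<in> set (steps xs)" for u v
  proof -
    have "{u, v} \<in> E" using assms that unfolding successively_iff_steps by auto
    then show ?thesis unfolding drawing_def by blast
  qed
  moreover have "path_image (walk_path \<gamma> xs) = (\<Union>(u, v) \<in> set (steps xs). path_image (\<gamma> u v))"
    using walk_path_basic[OF assms] by blast
  ultimately show ?thesis by auto
qed

text \<open>Since \<open>u\<close> does not recur in a distinct walk, the first arc meets the rest
  of the walk only in the vertex \<open>v\<close> where the two are joined.\<close>

lemma arc_walk_path:
  assumes "walk xs" "distinct xs"
  shows "arc (walk_path \<gamma> xs)"
  using assms
proof (induction xs rule: induct_list012)
  case (3 u v zs)
  show ?case
  proof (cases zs)
    case Nil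
    then show ?thesis using 3 edge_arc[of u v] by auto
  next
    case (Cons w ws)
    note 4 = 3[unfolded Cons]
    have uv: "{u, v} \<in> E" using 4 by auto
    have w: "walk (v # w # ws)" using 4 by auto
    note wb = walk_path_basic[OF w]
    have "path_image (\<gamma> u v) \<inter> path_image (\<gamma> x y) \<subseteq> {v}" if "(x, y) \<in> set (steps (v # w # ws))" for x y
    proof -
      have "{x, y} \<in> E" using w that unfolding successively_iff_steps by auto
      moreover have "x \<noteq> u" "y \<noteq> u" using steps_subset[OF that] 4 by auto
      moreover from this have "{u, v} \<noteq> {x, y}" by blast
      ultimately show ?thesis using edges_meet[OF uv, of x y] by blast
    qed
    then have "path_image (\<gamma> u v) \<inter> path_image (walk_path \<gamma> (v # w # ws)) \<subseteq> {v}"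
      unfolding wb[THEN conjunct2, THEN conjunct2, THEN conjunct2] by blast
    then have "arc (\<gamma> u v +++ walk_path \<gamma> (v # w # ws))"
      by (intro arc_join) (use 4 wb edge_arc[OF uv] w in auto)
    then show ?thesis using Cons by simp
  qed
qed auto

lemma closed_walk:
  assumes "3 \<le> length p" "cyc_edges p \<subseteq> E"
  shows "walk (p @ [hd p])"
proof -
  have "p \<noteq> []" using assms by auto
  then show ?thesis
    using assms cyc_edges_steps[of p] by (auto simp: successively_iff_steps)
qed

text \<open>The cycle is its first edge \<open>{u, v}\<close> followed by the arc along
  \<open>q\<close>, which leads through the other vertices back to \<open>u\<close>. The two arcs
  meet only in \<open>u\<close> and \<open>v\<close>, so their join is a simple loop.\<close>

lemma simple_path_cycle:
  assumes "3 \<le> length p" "distinct p" "cyc_edges p \<subseteq> E"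
  shows "simple_path (cycle_path \<gamma> p)" "pathfinish (cycle_path \<gamma> p) = pathstart (cycle_path \<gamma> p)"
proof -
  obtain u v w ws where p: "p = u # v # w # ws"
    using assms(1) by (metis Suc_le_length_iff numeral_3_eq_3)
  have w: "walk (p @ [hd p])" using closed_walk assms by blast
  define q where "q = v # w # ws @ [u]"
  have wq: "walk q" "distinct q" using w assms unfolding p q_def by auto
  have uv: "{u, v} \<in> E" using w unfolding p by auto
  note wb = walk_path_basic[OF wq(1)]
  have "path_image (\<gamma> u v) \<inter> path_image (\<gamma> x y) \<subseteq> {u, v}" if xy: "(x, y) \<in> set (steps q)" for x y
  proof -
    have "(x, y) \<in> set (steps (p @ [hd p]))" using xy by (simp add: p q_def)
    \<comment> \<open>Here the length bound enters: with two vertices the walk would return along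
      its first edge.\<close>
    then have "(x, y) \<noteq> (v, u)" using steps_closed_asym[OF assms(2,1), of u v] by (auto simp: p)
    moreover have "(x, y) \<noteq> (u, v)"
      using xy distinct_steps_closed[of p] assms(2) by (auto simp: p q_def)
    moreover have "{x, y} \<in> E" using wq xy unfolding successively_iff_steps by auto
    ultimately show ?thesis using edges_meet[OF uv, of x y] by (auto simp: doubleton_eq_iff)
  qed
  then have "path_image (\<gamma> u v) \<inter> path_image (walk_path \<gamma> q) \<subseteq> {u, v}"
    unfolding wb[THEN conjunct2, THEN conjunct2, THEN conjunct2] by blast
  then have "simple_path (\<gamma> u v +++ walk_path \<gamma> q)"
    by (intro simple_path_join_loop arc_walk_path) (use wq wb edge_arc[OF uv] in \<open>auto simp: q_def\<close>)
  then show "simple_path (cycle_path \<gamma> p)"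
    by (simp add: cycle_path_def p q_def)
  show "pathfinish (cycle_path \<gamma> p) = pathstart (cycle_path \<gamma> p)"
    using walk_path_basic[OF w] by (simp add: cycle_path_def p)
qed

lemma winding_number_walk:
  assumes "walk xs" "z \<notin> path_image (walk_path \<gamma> xs)"
  shows "winding_number (walk_path \<gamma> xs) z = (\<Sum>(u, v) \<leftarrow> steps xs. winding_number (\<gamma> u v) z)"
  using assms
proof (induction xs rule: induct_list012)
  case (3 u v zs)
  show ?case
  proof (cases zs)
    case Nil
    then show ?thesis by auto
  next
    case (Cons w ws)
    note 4 = 3[unfolded Cons]
    have w: "walk (v # w # ws)" using 4 by auto
    have uv: "{u, v} \<in> E" using 4 by auto
    note wb = walk_path_basic[OF w]
    have "z \<notin> path_image (\<gamma> u v)" "z \<notin> path_image (walk_path \<gamma> (v # w # ws))"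
      using 4(4) wb edge_arc[OF uv] by (auto simp: path_image_join)
    then show ?thesis using 4 w wb edge_arc[OF uv] Cons by (simp add: winding_number_join)
  qed
qed auto

lemma finite_edge_pairs: "finite {(x, y). {x, y} \<in> E}"
proof (rule finite_subset)
  show "{(x, y). {x, y} \<in> E} \<subseteq> V \<times> V" using edge_subset by auto
  show "finite (V \<times> V)" using simple unfolding simple_graph_def by auto
qed

text \<open>The parameter \<open>1/2\<close> gives such a point, because the arc is injective.
  Winding numbers on the two sides of an edge are compared near a point of this kind.\<close>

lemma inner_point:
  assumes "{u, v} \<in> E"
  obtains m where "m \<in> path_image (\<gamma> u v)" "m \<notin> V"
proof -
  have "\<gamma> u v (1/2) \<noteq> \<gamma> u v 0" "\<gamma> u v (1/2) \<noteq> \<gamma> u v 1"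
    using edge_arc(1)[OF assms] by (auto simp: arc_def dest: inj_onD)
  moreover have "\<gamma> u v (1/2) \<in> path_image (\<gamma> u v)" by (auto simp: path_image_def)
  ultimately show ?thesis
    using edge_arc(3,4,6)[OF assms] that[of "\<gamma> u v (1/2)"] by (auto simp: pathstart_def pathfinish_def)
qed

lemma inner_point_not_other:
  assumes "{u, v} \<in> E" "m \<in> path_image (\<gamma> u v)" "m \<notin> V" "{x, y} \<in> E" "{x, y} \<noteq> {u, v}"
  shows "m \<notin> path_image (\<gamma> x y)"
  using edges_meet[OF assms(1,4)] assms edge_subset by blast

text \<open>The arcs of all other edges stay away from \<open>m\<close>, so their contributions add
  up to a function \<open>g\<close> continuous at \<open>m\<close>. Traversals of
  \<open>{u, v}\<close> in opposite directions contribute opposite winding numbers, which leaves the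
  coefficient \<open>net u v xs\<close>.\<close>

lemma winding_number_split:
  assumes "{u, v} \<in> E" "m \<in> path_image (\<gamma> u v)" "m \<notin> V" "walk xs"
  obtains g where "isCont g m"
    "\<And>z. z \<notin> drawing V E \<gamma> \<Longrightarrow>
      winding_number (walk_path \<gamma> xs) z = of_int (net u v xs) * winding_number (\<gamma> u v) z + g z"
proof -
  define g where "g = (\<lambda>z. \<Sum>(x, y) \<leftarrow> filter (\<lambda>(x, y). {x, y} \<noteq> {u, v}) (steps xs). winding_number (\<gamma> x y) z)"
  have E: "\<forall>(x, y) \<in> set (steps xs). {x, y} \<in> E" using assms(4) by (simp add: successively_iff_steps)
  have "isCont (\<lambda>z. \<Sum>(x, y) \<leftarrow> l. winding_number (\<gamma> x y) z) m"
    if "\<forall>(x, y) \<in> set l. {x, y} \<in> E \<and> {x, y} \<noteq> {u, v}" for l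
    using that
  proof (induction l)
    case (Cons a l)
    obtain x y where a: "a = (x, y)" by force
    have xy: "{x, y} \<in> E" "{x, y} \<noteq> {u, v}" using Cons a by auto
    have "isCont (winding_number (\<gamma> x y)) m"
      using continuous_at_winding_number[OF edge_arc(2)[OF xy(1)]] inner_point_not_other[OF assms(1,2,3) xy]
      by blast
    moreover have "isCont (\<lambda>z. \<Sum>(x, y) \<leftarrow> l. winding_number (\<gamma> x y) z) m"
      using Cons by auto
    ultimately show ?case by (simp add: a)
  qed auto
  from this[of "filter (\<lambda>(x, y). {x, y} \<noteq> {u, v}) (steps xs)"] E have "isCont g m"
    unfolding g_def by fastforce
  moreover have "winding_number (walk_path \<gamma> xs) z = of_int (net u v xs) * winding_number (\<gamma> u v) z + g z"
    if z: "z \<notin> drawing V E \<gamma>" for z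
  proof -
    define w where "w = (\<lambda>(x, y). winding_number (\<gamma> x y) z)"
    have "z \<notin> path_image (\<gamma> u v)" using z assms(1) by (auto simp: drawing_def)
    then have w: "w (v, u) = - w (u, v)"
      using edge_arc[OF assms(1)] by (simp add: winding_number_reversepath w_def)
    have "sum_list (map w l) = of_int (int (count_list l (u, v)) - int (count_list l (v, u))) * w (u, v)
        + sum_list (map w (filter (\<lambda>(x, y). {x, y} \<noteq> {u, v}) l))" for l
    proof (induction l)
      case (Cons a l)
      obtain x y where a: "a = (x, y)" by force
      have uv: "u \<noteq> v" using edge_neq assms by blast
      consider "a = (u, v)" | "a = (v, u)" | "{x, y} \<noteq> {u, v}" "a \<noteq> (u, v)" "a \<noteq> (v, u)"
        using a by (auto simp: doubleton_eq_iff)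
      then show ?case
        using Cons uv w by cases (auto simp: a algebra_simps insert_commute)
    qed auto
    from this[of "steps xs"] show ?thesis
      using winding_number_walk[OF assms(4), of z] walk_path_image_subset[OF assms(4)] z
      unfolding g_def net_def w_def by (metis (no_types, lifting) case_prod_conv subsetD)
  qed
  ultimately show ?thesis using that by blast
qed

text \<open>When the coefficients of \<open>{u, v}\<close> cancel, \<open>F\<close> agrees off the
  drawing with a function \<open>G\<close> continuous at \<open>m\<close>. Closed walks make
  \<open>F\<close> integer-valued there, so it takes a single value near \<open>m\<close>, on both
  sides of the edge.\<close>

lemma locally_constant_off_edge:
  fixes C :: "'k \<Rightarrow> complex list" and a :: "'k \<Rightarrow> int"
  assumes "{u, v} \<in> E" "m \<in> path_image (\<gamma> u v)" "m \<notin> V" "finite K"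
    and C: "\<And>k. k \<in> K \<Longrightarrow> walk (C k) \<and> hd (C k) = last (C k)"
    and zero: "(\<Sum>k\<in>K. a k * net u v (C k)) = 0"
  defines "F \<equiv> \<lambda>z. \<Sum>k\<in>K. of_int (a k) * winding_number (walk_path \<gamma> (C k)) z"
  obtains \<epsilon> where "\<epsilon> > 0"
    "\<And>z z'. z \<in> ball m \<epsilon> - drawing V E \<gamma> \<Longrightarrow> z' \<in> ball m \<epsilon> - drawing V E \<gamma> \<Longrightarrow> F z = F z'"
proof -
  have "\<exists>g. isCont g m \<and> (\<forall>z. z \<notin> drawing V E \<gamma> \<longrightarrow>
      winding_number (walk_path \<gamma> (C k)) z = of_int (net u v (C k)) * winding_number (\<gamma> u v) z + g z)"
    if "k \<in> K" for k
    using winding_number_split[OF assms(1-3), of "C k"] C[OF that] by metis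
  then obtain g where g: "\<And>k. k \<in> K \<Longrightarrow> isCont (g k) m"
    "\<And>k z. k \<in> K \<Longrightarrow> z \<notin> drawing V E \<gamma> \<Longrightarrow>
      winding_number (walk_path \<gamma> (C k)) z = of_int (net u v (C k)) * winding_number (\<gamma> u v) z + g k z"
    by metis
  define G where "G = (\<lambda>z. \<Sum>k\<in>K. of_int (a k) * g k z)"
  have FG: "F z = G z" if "z \<notin> drawing V E \<gamma>" for z
  proof -
    have "F z = (\<Sum>k\<in>K. of_int (a k * net u v (C k)) * winding_number (\<gamma> u v) z + of_int (a k) * g k z)"
      unfolding F_def by (rule sum.cong) (use g(2) that in \<open>auto simp: algebra_simps\<close>)
    also have "\<dots> = of_int (\<Sum>k\<in>K. a k * net u v (C k)) * winding_number (\<gamma> u v) z + G z"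
      by (simp add: G_def sum.distrib sum_distrib_right)
    finally show ?thesis using zero by simp
  qed
  have int: "F z \<in> \<int>" if "z \<notin> drawing V E \<gamma>" for z
    unfolding F_def
  proof (intro Ints_sum Ints_mult Ints_of_int integer_winding_number)
    fix k assume k: "k \<in> K"
    then show "path (walk_path \<gamma> (C k))" "pathfinish (walk_path \<gamma> (C k)) = pathstart (walk_path \<gamma> (C k))"
      "z \<notin> path_image (walk_path \<gamma> (C k))"
      using walk_path_basic[OF C[OF k, THEN conjunct1]] C[OF k]
        walk_path_image_subset[OF C[OF k, THEN conjunct1]] that
      by (simp, simp, metis subsetD)
  qed
  have "isCont G m" unfolding G_def by (intro continuous_intros g)
  \<comment> \<open>The bound \<open>1/2\<close> makes any two values in the ball differ by less
    than 1, so as integers they agree.\<close>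
  then obtain \<epsilon> where e: "\<epsilon> > 0" "\<And>z. dist z m < \<epsilon> \<Longrightarrow> dist (G z) (G m) < 1/2"
    unfolding continuous_at_eps_delta using zero_less_divide_1_iff[of "2::real"] by (meson zero_less_numeral)
  show ?thesis
  proof (rule that[OF e(1)])
    fix z z' assume z: "z \<in> ball m \<epsilon> - drawing V E \<gamma>" "z' \<in> ball m \<epsilon> - drawing V E \<gamma>"
    then have "dist (G z) (G m) < 1/2" "dist (G z') (G m) < 1/2"
      using e(2)[of z] e(2)[of z'] by (simp_all add: dist_commute)
    then have "dist (G z) (G z') < 1" by (metis dist_triangle_half_l)
    moreover have "G z - G z' \<in> \<int>"
      using z int FG by (metis DiffD2 Ints_diff)
    ultimately have "G z = G z'"
      by (auto elim!: Ints_cases simp: dist_norm norm_of_int simp flip: of_int_abs)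
    then show "F z = F z'" using z FG by auto
  qed
qed

end

section \<open>Faces of a polygon chain\<close>

text \<open>Equal edges at different positions would again make each position the cyclic successor
  of the other.\<close>

lemma cyc_edge_inj:
  assumes "distinct p" "3 \<le> length p" "a < length p" "b < length p" "cyc_edge p a = cyc_edge p b"
  shows "a = b"
proof (rule ccontr)
  assume ne: "a \<noteq> b"
  have l: "Suc a mod length p < length p" "Suc b mod length p < length p"
    using assms(2) by (auto intro!: mod_less_divisor)
  have "p ! a \<noteq> p ! b" using assms ne by (simp add: nth_eq_iff_index_eq)
  then have "p ! a = p ! (Suc b mod length p)" "p ! b = p ! (Suc a mod length p)"
    using assms(5) by (auto simp: cyc_edge_def doubleton_eq_iff)
  then have h: "a = Suc b mod length p" "b = Suc a mod length p"
    using assms l by (simp_all add: nth_eq_iff_index_eq)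
  have ms: "Suc c mod length p = (if Suc c = length p then 0 else Suc c)" if "c < length p" for c
    using that by (simp add: mod_Suc)
  have "Suc b = length p \<and> a = 0 \<or> a = Suc b" "Suc a = length p \<and> b = 0 \<or> b = Suc a"
    using h(1)[unfolded ms[OF assms(4)]] h(2)[unfolded ms[OF assms(3)]] by argo+
  then show False using assms(2) by linarith
qed

lemma card_cyc_edges: "distinct p \<Longrightarrow> 3 \<le> length p \<Longrightarrow> card (cyc_edges p) = length p"
  unfolding cyc_edges_def using cyc_edge_inj[of p] by (subst card_image) (auto simp: inj_on_def)

lemma cyc_edges_subset: "e \<in> cyc_edges p \<Longrightarrow> e \<subseteq> set p"
  by (auto simp: cyc_edges_def cyc_edge_def intro!: nth_mem mod_less_divisor)

lemma rtrancl_edges_walk: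
  assumes "(x, y) \<in> {(x, y). {x, y} \<in> E}\<^sup>*"
  shows "\<exists>zs. zs \<noteq> [] \<and> hd zs = x \<and> last zs = y \<and> successively (\<lambda>u v. {u, v} \<in> E) zs"
  using assms
proof (induction rule: rtrancl_induct)
  case base
  show ?case by (rule exI[of _ "[x]"]) auto
next
  case (step y z)
  then obtain zs where "zs \<noteq> []" "hd zs = x" "last zs = y" "successively (\<lambda>u v. {u, v} \<in> E) zs"
    by blast
  then show ?case using step(2)
    by (intro exI[of _ "zs @ [z]"]) (auto simp: successively_append_iff)
qed

text \<open>The head is treated apart because a walk with a single vertex uses no edge.\<close>

lemma set_subset_Union_edges:
  assumes "successively (\<lambda>u v. {u, v} \<in> E) zs" "zs \<noteq> []"
  shows "set zs \<subseteq> insert (hd zs) (\<Union>E)"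
  using assms by (induction zs rule: induct_list012) auto

lemma vertex_steps:
  assumes "p \<noteq> []" "v \<in> set p"
  obtains x y where "(x, v) \<in> set (steps (p @ [hd p]))" "(v, y) \<in> set (steps (p @ [hd p]))"
proof -
  obtain a where a: "a < length p" "v = p ! a" using assms(2) by (auto simp: in_set_conv_nth)
  define b where "b = (if a = 0 then length p - 1 else a - 1)"
  have b: "b < length p" "Suc b mod length p = a"
    using a assms(1) by (auto simp: b_def)
  have "(p ! b, v) \<in> set (steps (p @ [hd p]))" "(v, p ! (Suc a mod length p)) \<in> set (steps (p @ [hd p]))"
    unfolding steps_closed[OF assms(1)] using a b by auto
  then show ?thesis using that by blast
qed

section \<open>Interiors, boundaries and common vertices of the faces\<close>

locale drawn_chain =
  fixes V :: "complex set" and E :: "complex set set"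
    and \<gamma> :: "complex \<Rightarrow> complex \<Rightarrow> real \<Rightarrow> complex" and ps :: "complex list list"
  assumes chain: "polygon_chain V E \<gamma> ps"
begin

lemma chain_facts:
  shows "2 \<le> length ps" "plane_graph V E \<gamma>" "two_connected V E"
    and "\<forall>p \<in> set ps. distinct p \<and> 4 \<le> length p \<and> clockwise \<gamma> p"
    and V_eq: "V = (\<Union>p \<in> set ps. set p)" and E_eq: "E = (\<Union>p \<in> set ps. cyc_edges p)"
    and bounded_faces: "{F \<in> plane_faces V E \<gamma>. bounded F} = cycle_interior \<gamma> ` set ps"
    and adjacent: "\<forall>j. Suc j < length ps \<longrightarrow> card (cyc_edges (ps ! j) \<inter> cyc_edges (ps ! Suc j)) = 1"
    and nonadjacent: "\<forall>i j. Suc i < j \<and> j < length ps \<longrightarrow> cyc_edges (ps ! i) \<inter> cyc_edges (ps ! j) = {}"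
    and at_most_two: "\<forall>v \<in> V. card {j. j < length ps \<and> v \<in> set (ps ! j)} \<le> 2"
  using chain unfolding polygon_chain_def by - (elim conjE, assumption)+

sublocale drawn_graph V E \<gamma>
  by unfold_locales (rule chain_facts(2))

abbreviation closed_face :: "nat \<Rightarrow> complex list" where
  "closed_face j \<equiv> ps ! j @ [hd (ps ! j)]"

abbreviation face_interior :: "nat \<Rightarrow> complex set" where
  "face_interior j \<equiv> cycle_interior \<gamma> (ps ! j)"

lemma face:
  assumes "j < length ps"
  shows "distinct (ps ! j)" "4 \<le> length (ps ! j)" "3 \<le> length (ps ! j)" "ps ! j \<noteq> []"
    "clockwise \<gamma> (ps ! j)" "cyc_edges (ps ! j) \<subseteq> E" "set (ps ! j) \<subseteq> V"
proof -
  have "ps ! j \<in> set ps" using assms by simp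
  then show "distinct (ps ! j)" "4 \<le> length (ps ! j)" "clockwise \<gamma> (ps ! j)"
    "cyc_edges (ps ! j) \<subseteq> E" "set (ps ! j) \<subseteq> V"
    using chain_facts(4) V_eq E_eq by auto
  then show "3 \<le> length (ps ! j)" "ps ! j \<noteq> []" by auto
qed

lemma closed_face:
  assumes "j < length ps"
  shows "walk (closed_face j)" "hd (closed_face j) = last (closed_face j)"
    "walk_path \<gamma> (closed_face j) = cycle_path \<gamma> (ps ! j)"
  using closed_walk[OF face(3,6)[OF assms]] face(4)[OF assms] by (simp_all add: cycle_path_def)

lemma face_path:
  assumes "j < length ps"
  shows "simple_path (cycle_path \<gamma> (ps ! j))" "path (cycle_path \<gamma> (ps ! j))"
    "pathfinish (cycle_path \<gamma> (ps ! j)) = pathstart (cycle_path \<gamma> (ps ! j))"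
    "path_image (cycle_path \<gamma> (ps ! j)) \<subseteq> drawing V E \<gamma>"
    "path_image (cycle_path \<gamma> (ps ! j)) = (\<Union>(u, v) \<in> set (steps (closed_face j)). path_image (\<gamma> u v))"
  using simple_path_cycle[OF face(3,1,6)[OF assms]] walk_path_image_subset[OF closed_face(1)[OF assms]]
    closed_face(3)[OF assms] walk_path_basic[OF closed_face(1)[OF assms]] simple_path_imp_path
  by simp_all

lemma face_component:
  assumes "j < length ps"
  shows "face_interior j \<in> components (- drawing V E \<gamma>)"
proof -
  have "face_interior j \<in> {F \<in> plane_faces V E \<gamma>. bounded F}"
    unfolding bounded_faces using assms by simp
  then show ?thesis by (simp add: plane_faces_def)
qed

lemma face_off_drawing:
  assumes "j < length ps" "z \<in> face_interior j"
  shows "z \<notin> drawing V E \<gamma>"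
  using in_components_subset[OF face_component[OF assms(1)]] assms(2) by blast

lemma winding_inside:
  assumes "j < length ps" "z \<in> face_interior j"
  shows "winding_number (walk_path \<gamma> (closed_face j)) z = -1"
  using face(5)[OF assms(1)] assms(2) closed_face(3)[OF assms(1)] by (simp add: clockwise_def)

lemma winding_outside:
  assumes "j < length ps" "z \<notin> face_interior j" "z \<notin> drawing V E \<gamma>"
  shows "winding_number (walk_path \<gamma> (closed_face j)) z = 0"
proof -
  have "z \<notin> path_image (cycle_path \<gamma> (ps ! j))" using face_path(4) assms by blast
  then have "z \<in> outside (path_image (cycle_path \<gamma> (ps ! j)))"
    using assms(2) inside_Un_outside unfolding cycle_interior_def by blast
  then show ?thesis
    unfolding closed_face(3)[OF assms(1)]
    by (rule winding_number_zero_in_outside[OF face_path(2,3)[OF assms(1)]])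
qed

text \<open>Two faces have at most one common edge, whereas each has at least four edges.\<close>

lemma edge_not_shared:
  assumes "i < length ps" "j < length ps" "i \<noteq> j"
  obtains u v where "(u, v) \<in> set (steps (closed_face i))" "{u, v} \<notin> cyc_edges (ps ! j)"
proof -
  have le: "card (cyc_edges (ps ! i) \<inter> cyc_edges (ps ! j)) \<le> 1"
    if "i < j" "j < length ps" for i j
  proof (cases "j = Suc i")
    case True
    then show ?thesis using that adjacent by simp
  next
    case False
    then have "cyc_edges (ps ! i) \<inter> cyc_edges (ps ! j) = {}" using that nonadjacent by simp
    then show ?thesis by simp
  qed
  have "card (cyc_edges (ps ! i) \<inter> cyc_edges (ps ! j)) \<le> 1"
    using le[of i j] le[of j i] assms by (metis Int_commute linorder_neqE_nat)
  moreover have "4 \<le> card (cyc_edges (ps ! i))"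
    using face[OF assms(1)] by (simp add: card_cyc_edges)
  ultimately have "\<not> cyc_edges (ps ! i) \<subseteq> cyc_edges (ps ! j)"
    by (metis inf.absorb1 numeral_le_one_iff order.trans semiring_norm(69))
  then show ?thesis
    using that unfolding cyc_edges_steps[OF face(4)[OF assms(1)]] by auto
qed

lemma cyc_edges_face: "j < length ps \<Longrightarrow>
    {u, v} \<in> cyc_edges (ps ! j) \<longleftrightarrow>
    (u, v) \<in> set (steps (closed_face j)) \<or> (v, u) \<in> set (steps (closed_face j))"
  by (auto simp: cyc_edges_steps face(4) doubleton_eq_iff image_iff split: prod.splits)

text \<open>Interiors are components, so they coincide if they meet. By the Jordan curve theorem a
  boundary is the frontier of its interior, so the two boundaries would be the same point set; an
  inner point of an edge that only face \<open>i\<close> has contradicts this.\<close>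

lemma faces_disjoint:
  assumes "i < length ps" "j < length ps" "i \<noteq> j"
  shows "face_interior i \<inter> face_interior j = {}"
proof (rule ccontr)
  assume "face_interior i \<inter> face_interior j \<noteq> {}"
  then have eq: "face_interior i = face_interior j"
    using components_nonoverlap[OF face_component[OF assms(1)] face_component[OF assms(2)]] by blast
  have "path_image (cycle_path \<gamma> (ps ! k)) = frontier (face_interior k)" if "k < length ps" for k
    using Jordan_inside_outside[OF face_path(1,3)[OF that]] by (simp add: cycle_interior_def)
  then have img: "path_image (cycle_path \<gamma> (ps ! i)) = path_image (cycle_path \<gamma> (ps ! j))"
    using eq assms by metis
  obtain u v where uv: "(u, v) \<in> set (steps (closed_face i))" "{u, v} \<notin> cyc_edges (ps ! j)"
    using edge_not_shared[OF assms] by blast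
  have uvE: "{u, v} \<in> E" using uv(1) cyc_edges_face face(6) assms(1) by blast
  then obtain m where m: "m \<in> path_image (\<gamma> u v)" "m \<notin> V" by (rule inner_point)
  have "m \<in> path_image (cycle_path \<gamma> (ps ! j))"
    unfolding img[symmetric] face_path(5)[OF assms(1)] using m uv by blast
  then obtain x y where xy: "(x, y) \<in> set (steps (closed_face j))" "m \<in> path_image (\<gamma> x y)"
    unfolding face_path(5)[OF assms(2)] by blast
  then have "{x, y} \<in> cyc_edges (ps ! j)" using cyc_edges_face assms(2) by blast
  then have "{x, y} \<in> E" "{x, y} \<noteq> {u, v}" using uv face(6)[OF assms(2)] by auto
  then show False using inner_point_not_other[OF uvE m] xy by blast
qed

text \<open>By the Jordan curve theorem \<open>m\<close> is a limit both of the inside and of the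
  outside of the boundary of face \<open>j\<close>. The point found outside must also avoid the
  drawing.\<close>

lemma near_edge:
  assumes j: "j < length ps" and uv: "{u, v} \<in> cyc_edges (ps ! j)"
    and m: "m \<in> path_image (\<gamma> u v)" "m \<notin> V" and "\<epsilon> > 0"
  shows "\<exists>z. z \<in> ball m \<epsilon> - drawing V E \<gamma> \<and> z \<in> face_interior j"
    and "\<exists>z. z \<in> ball m \<epsilon> - drawing V E \<gamma> \<and> z \<notin> face_interior j"
proof -
  let ?P = "path_image (cycle_path \<gamma> (ps ! j))"
  have uvE: "{u, v} \<in> E" using uv face(6)[OF j] by blast
  have uvP: "path_image (\<gamma> u v) \<subseteq> ?P"
    unfolding face_path(5)[OF j] using uv cyc_edges_face[OF j] edge_arc(7)[OF uvE] by fastforce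
  have J: "frontier (inside ?P) = ?P" "frontier (outside ?P) = ?P"
    using Jordan_inside_outside[OF face_path(1,3)[OF j]] by auto
  have cl: "m \<in> closure (inside ?P)" "m \<in> closure (outside ?P)"
    using J uvP m(1) by (auto simp: frontier_def)
  obtain z where "z \<in> inside ?P" "dist z m < \<epsilon>"
    using cl(1) \<open>\<epsilon> > 0\<close> unfolding closure_approachable by blast
  then show "\<exists>z. z \<in> ball m \<epsilon> - drawing V E \<gamma> \<and> z \<in> face_interior j"
    using face_off_drawing[OF j, of z] by (auto simp: cycle_interior_def dist_commute)
  \<comment> \<open>\<open>D\<close> is the drawing without the edge \<open>{u, v}\<close>, apart
    from its ends. It is closed and misses \<open>m\<close>, so near \<open>m\<close> the drawing is
    contained in the boundary of face \<open>j\<close>.\<close>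
  define D where "D = V \<union> (\<Union>(x, y) \<in> {(x, y). {x, y} \<in> E} - {(u, v), (v, u)}. path_image (\<gamma> x y))"
  have "closed D"
    unfolding D_def
  proof (intro closed_Un closed_UN ballI)
    show "closed V" using simple by (simp add: simple_graph_def finite_imp_closed)
    show "finite ({(x, y). {x, y} \<in> E} - {(u, v), (v, u)})" using finite_edge_pairs by simp
  qed (auto intro: closed_path_image edge_arc)
  moreover have "m \<notin> path_image (\<gamma> x y)" if "{x, y} \<in> E" "(x, y) \<noteq> (u, v)" "(x, y) \<noteq> (v, u)" for x y
    using inner_point_not_other[OF uvE m that(1)] that by (auto simp: doubleton_eq_iff)
  then have "m \<notin> D" using m(2) unfolding D_def by blast
  ultimately obtain \<delta> where \<delta>: "\<delta> > 0" "ball m \<delta> \<subseteq> - D"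
    by (meson open_contains_ball open_Compl ComplI)
  have "min \<delta> \<epsilon> > 0" using \<delta> \<open>\<epsilon> > 0\<close> by simp
  then obtain z where z: "z \<in> outside ?P" "dist z m < min \<delta> \<epsilon>"
    using cl(2) unfolding closure_approachable by blast
  have zP: "z \<notin> ?P" "z \<notin> inside ?P"
    using z(1) outside_no_overlap[of ?P] inside_Int_outside[of ?P] by blast+
  have "z \<notin> D" using z(2) \<delta>(2) by (auto simp: dist_commute)
  moreover have "z \<notin> path_image (\<gamma> u v)" "z \<notin> path_image (\<gamma> v u)"
    using zP(1) uvP edge_arc(7)[OF uvE] by blast+
  moreover have "drawing V E \<gamma> \<subseteq> D \<union> path_image (\<gamma> u v) \<union> path_image (\<gamma> v u)"
    unfolding drawing_def D_def by blast
  ultimately have "z \<notin> drawing V E \<gamma>" by blast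
  then show "\<exists>z. z \<in> ball m \<epsilon> - drawing V E \<gamma> \<and> z \<notin> face_interior j"
    using z zP(2) by (auto simp: cycle_interior_def dist_commute)
qed

text \<open>If both faces traversed the edge in the same direction, the difference of their winding
  numbers would have coefficient 0 on it and so be constant near an inner point. It is
  \<open>-1\<close> in face \<open>i\<close> and \<open>1\<close> in face \<open>j\<close>, and both
  come arbitrarily near.\<close>

lemma opposite_orientation:
  assumes "i < length ps" "j < length ps" "i \<noteq> j" "(u, v) \<in> set (steps (closed_face i))"
  shows "(u, v) \<notin> set (steps (closed_face j))"
proof
  assume uvj: "(u, v) \<in> set (steps (closed_face j))"
  have uv: "{u, v} \<in> cyc_edges (ps ! i)" "{u, v} \<in> cyc_edges (ps ! j)"
    using assms uvj cyc_edges_face by blast+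
  then have uvE: "{u, v} \<in> E" using face(6) assms by blast
  then obtain m where m: "m \<in> path_image (\<gamma> u v)" "m \<notin> V" by (rule inner_point)
  define a where "a k = (if k = i then 1 else -1 :: int)" for k
  define F where "F z = (\<Sum>k\<in>{i, j}. of_int (a k) * winding_number (walk_path \<gamma> (closed_face k)) z)" for z
  have "net u v (closed_face i) = 1" "net u v (closed_face j) = 1"
    using net_closed[OF face(1,3)[OF assms(1)] assms(4)] net_closed[OF face(1,3)[OF assms(2)] uvj]
    by simp_all
  then have zero: "(\<Sum>k\<in>{i, j}. a k * net u v (closed_face k)) = 0"
    using assms(3) by (simp add: a_def)
  have fin: "finite {i, j}" by simp
  have cw: "walk (closed_face k) \<and> hd (closed_face k) = last (closed_face k)" if "k \<in> {i, j}" for k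
    using that closed_face assms by blast
  obtain \<epsilon> where \<epsilon>: "\<epsilon> > 0"
    "\<And>z z'. z \<in> ball m \<epsilon> - drawing V E \<gamma> \<Longrightarrow> z' \<in> ball m \<epsilon> - drawing V E \<gamma> \<Longrightarrow> F z = F z'"
    using locally_constant_off_edge[OF uvE m fin cw zero] unfolding F_def by blast
  obtain z where z: "z \<in> ball m \<epsilon> - drawing V E \<gamma>" "z \<in> face_interior i"
    using near_edge(1)[OF assms(1) uv(1) m \<epsilon>(1)] by blast
  obtain z' where z': "z' \<in> ball m \<epsilon> - drawing V E \<gamma>" "z' \<in> face_interior j"
    using near_edge(1)[OF assms(2) uv(2) m \<epsilon>(1)] by blast
  have "z \<notin> face_interior j" "z' \<notin> face_interior i"
    using faces_disjoint[OF assms(1-3)] z z' by blast+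
  then have "F z = -1" "F z' = 1"
    using z z' assms by (simp_all add: F_def a_def winding_inside winding_outside)
  then show False using \<epsilon>(2)[OF z(1) z'(1)] by simp
qed

text \<open>The interiors of the faces are all the bounded components of the complement of the
  drawing. Any other point off the drawing therefore lies in an unbounded component, which a walk in
  the drawing cannot enclose.\<close>

lemma winding_unbounded:
  assumes "walk C" "hd C = last C" "z \<notin> drawing V E \<gamma>"
    and "\<And>k. k < length ps \<Longrightarrow> z \<notin> face_interior k"
  shows "winding_number (walk_path \<gamma> C) z = 0"
proof -
  let ?c = "connected_component_set (- drawing V E \<gamma>) z"
  have cz: "?c \<in> plane_faces V E \<gamma>" "z \<in> ?c"
    using assms(3) by (auto simp: plane_faces_def componentsI)
  have "\<not> bounded ?c"
  proof
    assume "bounded ?c"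
    then have "?c \<in> cycle_interior \<gamma> ` set ps"
      unfolding bounded_faces[symmetric] using cz(1) by blast
    then obtain k where "k < length ps" "?c = face_interior k"
      by (metis imageE in_set_conv_nth)
    then show False using assms(4) cz(2) by metis
  qed
  moreover have "?c \<subseteq> connected_component_set (- path_image (walk_path \<gamma> C)) z"
    using walk_path_image_subset[OF assms(1)] by (intro connected_component_mono) auto
  ultimately have "\<not> bounded (connected_component_set (- path_image (walk_path \<gamma> C)) z)"
    using bounded_subset by blast
  moreover have "z \<notin> path_image (walk_path \<gamma> C)"
    using assms(3) walk_path_image_subset[OF assms(1)] by (meson subsetD)
  ultimately have "z \<in> outside (path_image (walk_path \<gamma> C))"
    by (simp add: outside_def)
  then show ?thesis
    using walk_path_basic[OF assms(1)] assms(2) by (intro winding_number_zero_in_outside) auto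
qed

text \<open>The coefficient \<open>c k\<close> is the winding number of \<open>C\<close> around face \<open>k\<close>; the sign reflects that faces are
  listed clockwise.\<close>

lemma closed_walk_generated:
  assumes C: "walk C" "hd C = last C"
  obtains c :: "nat \<Rightarrow> int" where
    "\<And>u v. {u, v} \<in> E \<Longrightarrow> net u v C = - (\<Sum>k<length ps. c k * net u v (closed_face k))"
proof -
  let ?w = "winding_number (walk_path \<gamma> C)"
  let ?W = "\<lambda>k. winding_number (walk_path \<gamma> (closed_face k))"
  have loop: "path (walk_path \<gamma> C)" "pathfinish (walk_path \<gamma> C) = pathstart (walk_path \<gamma> C)"
    using walk_path_basic[OF C(1)] C(2) by auto
  have "\<exists>i. \<forall>z \<in> face_interior k. ?w z = of_int i" if k: "k < length ps" for k
  proof -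
    obtain z0 where z0: "z0 \<in> face_interior k"
      using in_components_nonempty[OF face_component[OF k]] by blast
    have dis: "face_interior k \<inter> path_image (walk_path \<gamma> C) = {}"
      using face_off_drawing[OF k] walk_path_image_subset[OF C(1)] by blast
    then have "?w z0 \<in> \<int>" using integer_winding_number[OF loop] z0 by blast
    then obtain i where "?w z0 = of_int i" by (rule Ints_cases)
    moreover have "?w z = ?w z0" if "z \<in> face_interior k" for z
      using winding_number_eq[OF loop that z0 in_components_connected[OF face_component[OF k]] dis] .
    ultimately show ?thesis by auto
  qed
  then obtain c where c: "\<And>k z. k < length ps \<Longrightarrow> z \<in> face_interior k \<Longrightarrow> ?w z = of_int (c k)"
    by metis
  \<comment> \<open>Face \<open>k\<close> has winding number \<open>-1\<close> on its interior and 0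
    on every other interior, and outside all faces both sides vanish. So the faces with weights
    \<open>c\<close> cancel the winding number of \<open>C\<close> everywhere off the
    drawing.\<close>
  have bal: "?w z + (\<Sum>k<length ps. of_int (c k) * ?W k z) = 0" if z: "z \<notin> drawing V E \<gamma>" for z
  proof (cases "\<exists>k<length ps. z \<in> face_interior k")
    case True
    then obtain k where k: "k < length ps" "z \<in> face_interior k" by blast
    have "?W l z = (if l = k then -1 else 0)" if "l < length ps" for l
      using winding_inside[OF k] winding_outside[OF that _ z] faces_disjoint[OF that k(1)] k(2) by auto
    then have "(\<Sum>l<length ps. of_int (c l) * ?W l z) = (\<Sum>l<length ps. if l = k then - of_int (c l) else 0)"
      by (intro sum.cong) auto
    then show ?thesis using c[OF k] k(1) by simp
  next
    case False
    then show ?thesis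
      using winding_unbounded[OF C z] winding_outside[OF _ _ z] by auto
  qed
  have main: "net u v C = - (\<Sum>k<length ps. c k * net u v (closed_face k))"
    if j: "j < length ps" and uv: "(u, v) \<in> set (steps (closed_face j))" for j u v
  proof -
    define n where "n = length ps"
    have uvj: "{u, v} \<in> cyc_edges (ps ! j)" using cyc_edges_face j uv by blast
    then have uvE: "{u, v} \<in> E" using face(6)[OF j] by blast
    then obtain m where m: "m \<in> path_image (\<gamma> u v)" "m \<notin> V" by (rule inner_point)
    \<comment> \<open>\<open>d\<close> is the amount by which the claim fails on
      \<open>(u, v)\<close>. Removing \<open>d\<close> copies of face \<open>j\<close> makes the
      coefficient of this edge cancel; the index \<open>n\<close> stands for \<open>C\<close>
      itself.\<close>
    define d where "d = net u v C + (\<Sum>k<n. c k * net u v (closed_face k))"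
    define a where "a k = (if k = n then 1 else c k - (if k = j then d else 0))" for k
    define C' where "C' k = (if k = n then C else closed_face k)" for k
    define F where "F z = (\<Sum>k\<in>{..n}. of_int (a k) * winding_number (walk_path \<gamma> (C' k)) z)" for z
    have split: "{..n} = insert n {..<n}" by auto
    have net1: "net u v (closed_face j) = 1" using net_closed[OF face(1,3)[OF j] uv] .
    have "(\<Sum>k\<in>{..n}. a k * net u v (C' k)) =
        net u v C + (\<Sum>k<n. c k * net u v (closed_face k) - (if k = j then d * net u v (closed_face k) else 0))"
      unfolding split by (subst sum.insert) (auto simp: a_def C'_def algebra_simps intro!: sum.cong)
    also have "\<dots> = 0" using j net1 by (simp add: sum_subtractf d_def n_def)
    finally have zero: "(\<Sum>k\<in>{..n}. a k * net u v (C' k)) = 0" .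
    \<comment> \<open>By \<open>bal\<close> only the removed copies of face \<open>j\<close> remain.
      They give \<open>d\<close> inside the face and 0 outside it, so constancy near
      \<open>m\<close> forces \<open>d = 0\<close>.\<close>
    have F: "F z = - of_int d * ?W j z" if "z \<notin> drawing V E \<gamma>" for z
    proof -
      have "F z = ?w z + (\<Sum>k<n. of_int (c k) * ?W k z - (if k = j then of_int d * ?W k z else 0))"
        unfolding F_def split by (subst sum.insert) (auto simp: a_def C'_def algebra_simps intro!: sum.cong)
      also have "\<dots> = ?w z + (\<Sum>k<n. of_int (c k) * ?W k z) - of_int d * ?W j z"
        using j by (simp add: sum_subtractf n_def)
      finally show ?thesis using bal[OF that] by (simp add: n_def)
    qed
    have cw: "walk (C' k) \<and> hd (C' k) = last (C' k)" if "k \<in> {..n}" for k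
      using that closed_face[of k] C by (cases "k = n") (simp_all add: C'_def n_def)
    obtain \<epsilon> where \<epsilon>: "\<epsilon> > 0"
      "\<And>z z'. z \<in> ball m \<epsilon> - drawing V E \<gamma> \<Longrightarrow> z' \<in> ball m \<epsilon> - drawing V E \<gamma> \<Longrightarrow> F z = F z'"
      using locally_constant_off_edge[OF uvE m finite_atMost cw zero] unfolding F_def by blast
    obtain z where z: "z \<in> ball m \<epsilon> - drawing V E \<gamma>" "z \<in> face_interior j"
      using near_edge(1)[OF j uvj m \<epsilon>(1)] by blast
    obtain z' where z': "z' \<in> ball m \<epsilon> - drawing V E \<gamma>" "z' \<notin> face_interior j"
      using near_edge(2)[OF j uvj m \<epsilon>(1)] by blast
    have "F z = of_int d" "F z' = 0"
      using F z z' winding_inside[OF j] winding_outside[OF j] by auto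
    then have "d = 0" using \<epsilon>(2)[OF z(1) z'(1)] by simp
    then show ?thesis by (simp add: d_def n_def)
  qed
  show ?thesis
  proof (rule that)
    fix u v assume "{u, v} \<in> E"
    then obtain j where j: "j < length ps" "{u, v} \<in> cyc_edges (ps ! j)"
      unfolding E_eq by (auto simp: in_set_conv_nth)
    then consider "(u, v) \<in> set (steps (closed_face j))" | "(v, u) \<in> set (steps (closed_face j))"
      using cyc_edges_face by blast
    then show "net u v C = - (\<Sum>k<length ps. c k * net u v (closed_face k))"
    proof cases
      case 1
      then show ?thesis using main j by blast
    next
      case 2
      then show ?thesis
        using main[OF j(1) 2] net_swap[of u v] by (simp add: sum_negf)
    qed
  qed
qed

text \<open>If the faces touched in \<open>v\<close> without a common edge there, the two edges of
  face \<open>i\<close> at \<open>v\<close> would lie on no other face, since at most two faces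
  contain \<open>v\<close>. By 2-connectedness some closed walk leaves \<open>v\<close> along one of
  them and returns along an edge of face \<open>j\<close>. Being a combination of faces, it has
  equal coefficients on \<open>(x, v)\<close> and \<open>(v, y)\<close>; yet it uses only the
  second.\<close>

lemma common_vertex_on_shared_edge:
  assumes ij: "i < length ps" "j < length ps" "i \<noteq> j" and v: "v \<in> set (ps ! i)" "v \<in> set (ps ! j)"
  shows "\<exists>e \<in> cyc_edges (ps ! i) \<inter> cyc_edges (ps ! j). v \<in> e"
proof (rule ccontr)
  assume no: "\<not> ?thesis"
  have vV: "v \<in> V" using v face(7) ij by blast
  have only: "k = i \<or> k = j" if "k < length ps" "v \<in> set (ps ! k)" for k
  proof (rule ccontr)
    assume "\<not> (k = i \<or> k = j)"
    then have "card {i, j, k} = 3" using ij by auto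
    moreover have "{i, j, k} \<subseteq> {j. j < length ps \<and> v \<in> set (ps ! j)}" using ij v that by auto
    then have "card {i, j, k} \<le> card {j. j < length ps \<and> v \<in> set (ps ! j)}" by (intro card_mono) auto
    moreover have "card {j. j < length ps \<and> v \<in> set (ps ! j)} \<le> 2" using at_most_two vV by blast
    ultimately show False by linarith
  qed
  obtain x y where xy: "(x, v) \<in> set (steps (closed_face i))" "(v, y) \<in> set (steps (closed_face i))"
    using vertex_steps[OF face(4)[OF ij(1)] v(1)] .
  obtain w where w: "(w, v) \<in> set (steps (closed_face j))"
    using vertex_steps[OF face(4)[OF ij(2)] v(2)] .
  have ei: "{x, v} \<in> cyc_edges (ps ! i)" "{v, y} \<in> cyc_edges (ps ! i)" and ej: "{w, v} \<in> cyc_edges (ps ! j)"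
    using xy w cyc_edges_face ij by blast+
  then have eE: "{x, v} \<in> E" "{v, y} \<in> E" "{w, v} \<in> E" using face(6) ij by blast+
  have wx: "w \<noteq> x" and wy: "w \<noteq> y"
    using no ei ej by (auto simp: insert_commute)
  have net0: "net s t (closed_face k) = (if k = i then net s t (closed_face i) else 0)"
    if "{s, t} \<in> cyc_edges (ps ! i)" "v \<in> {s, t}" "k < length ps" for s t k
  proof (cases "k = i")
    case False
    have "{s, t} \<notin> cyc_edges (ps ! k)"
    proof
      assume st: "{s, t} \<in> cyc_edges (ps ! k)"
      then have "v \<in> set (ps ! k)" using that(2) cyc_edges_subset by blast
      then have "k = j" using only[OF that(3)] False by blast
      then show False using no st that by blast
    qed
    then show ?thesis using False cyc_edges_face[OF that(3)] by (simp add: net_eq_0)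
  qed simp
  have conn: "connected_graph (V - {v}) (delete_vertices E {v})"
    using chain_facts(3) vV unfolding two_connected_def by blast
  have "y \<in> V - {v}" "w \<in> V - {v}" using eE edge_subset edge_neq by blast+
  then have "(y, w) \<in> {(x, y). {x, y} \<in> delete_vertices E {v}}\<^sup>*"
    using conn unfolding connected_graph_def by blast
  from rtrancl_edges_walk[OF this] obtain zs where zs: "zs \<noteq> []" "hd zs = y" "last zs = w"
    "successively (\<lambda>u v'. {u, v'} \<in> delete_vertices E {v}) zs"
    by (elim exE conjE)
  have vzs: "v \<notin> set zs"
    using set_subset_Union_edges[OF zs(4,1)] zs(2) \<open>y \<in> V - {v}\<close> by (auto simp: delete_vertices_def)
  have szs: "successively (\<lambda>u v'. {u, v'} \<in> E) zs"
    using zs(4) unfolding successively_iff_steps delete_vertices_def by auto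
  define C where "C = v # zs @ [v]"
  have steps_C: "steps C = (v, y) # steps zs @ [(w, v)]"
  proof -
    have "steps C = steps ([v] @ zs @ [v])" by (simp add: C_def)
    then show ?thesis using zs by (simp add: steps_append del: append.simps)
  qed
  have "walk C"
    using szs eE by (auto simp: C_def[symmetric] successively_iff_steps steps_C) (auto simp: C_def)
  moreover have "hd C = last C" by (simp add: C_def)
  ultimately obtain c where c:
    "\<And>u v. {u, v} \<in> E \<Longrightarrow> net u v C = - (\<Sum>k<length ps. c k * net u v (closed_face k))"
    using closed_walk_generated by blast
  have val: "net s t C = - c i"
    if st: "(s, t) \<in> set (steps (closed_face i))" "v \<in> {s, t}" for s t
  proof -
    have e: "{s, t} \<in> cyc_edges (ps ! i)" using st cyc_edges_face ij by blast
    then have "net s t C = - (\<Sum>k<length ps. c k * net s t (closed_face k))"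
      using c face(6) ij by blast
    also have "(\<Sum>k<length ps. c k * net s t (closed_face k))
        = (\<Sum>k<length ps. if k = i then c k else 0)"
      using net0[OF e st(2)] net_closed[OF face(1,3)[OF ij(1)] st(1)] by (intro sum.cong) auto
    finally show ?thesis using ij(1) by simp
  qed
  \<comment> \<open>As \<open>zs\<close> avoids \<open>v\<close>, the edges at \<open>v\<close>
    occur in \<open>C\<close> only as its first and its last step.\<close>
  have "(v, y) \<notin> set (steps zs)" "(y, v) \<notin> set (steps zs)" "(x, v) \<notin> set (steps zs)" "(v, x) \<notin> set (steps zs)"
    using vzs steps_subset by fastforce+
  moreover have "x \<noteq> y"
    using steps_closed_asym[OF face(1,3)[OF ij(1)] xy(1)] xy(2) by auto
  ultimately have "net v y C = 1" "net x v C = 0"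
    using wx wy eE edge_neq by (auto simp: net_def steps_C)
  then show False using val[OF xy(1)] val[OF xy(2)] by simp
qed

end

section \<open>Gluing matchings along an edge\<close>

text \<open>One side of a cut graph: the vertices in \<open>S\<close> are already covered from the
  other side, and those in \<open>Q\<close> must be covered here, because the other side leaves the
  far end of some edge at them uncovered.\<close>

definition constrained_matchings :: "'a set set \<Rightarrow> 'a set \<Rightarrow> 'a set \<Rightarrow> 'a set set set" where
  "constrained_matchings E S Q = {M. maximal_matching (delete_vertices E S) M \<and> Q \<subseteq> \<Union>M}"

text \<open>A larger matching contains an additional edge disjoint from \<open>M\<close>, and
  conversely one such edge can be added. The empty set is excluded as an edge because it meets
  nothing.\<close>

lemma maximal_matching_iff:
  assumes "{} \<notin> E"
  shows "maximal_matching E M \<longleftrightarrow> M \<subseteq> E \<and> pairwise disjnt M \<and> (\<forall>e\<in>E. e \<inter> \<Union>M \<noteq> {})"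
proof (intro iffI conjI ballI notI)
  assume max: "maximal_matching E M"
  then have M: "M \<subseteq> E" "pairwise disjnt M" by (auto simp: maximal_matching_def matching_def)
  show "M \<subseteq> E" "pairwise disjnt M" by (fact M)+
  fix e assume e: "e \<in> E" "e \<inter> \<Union>M = {}"
  then have "matching E (insert e M)"
    using M unfolding matching_def pairwise_insert disjnt_def by blast
  moreover have "e \<notin> M"
  proof
    assume "e \<in> M"
    then have "e = {}" using e(2) by blast
    then show False using e(1) assms by simp
  qed
  ultimately show False using max unfolding maximal_matching_def by blast
next
  assume h: "M \<subseteq> E \<and> pairwise disjnt M \<and> (\<forall>e\<in>E. e \<inter> \<Union>M \<noteq> {})"
  have False if M': "matching E M'" "M \<subset> M'" for M'
  proof -
    obtain e where e: "e \<in> M'" "e \<notin> M" using M' by blast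
    then have "e \<inter> f = {}" if "f \<in> M" for f
      using that M' unfolding matching_def pairwise_def disjnt_def by (metis psubsetD)
    then show False using h e M' unfolding matching_def by blast
  qed
  then show "maximal_matching E M" using h unfolding maximal_matching_def matching_def by blast
qed

lemma constrained_matchings_iff:
  assumes "{} \<notin> E"
  shows "M \<in> constrained_matchings E S Q \<longleftrightarrow>
    M \<subseteq> E \<and> pairwise disjnt M \<and> \<Union>M \<inter> S = {} \<and> (\<forall>e\<in>E. e \<inter> (\<Union>M \<union> S) \<noteq> {}) \<and> Q \<subseteq> \<Union>M"
proof -
  have "maximal_matching (delete_vertices E S) M \<longleftrightarrow>
      M \<subseteq> delete_vertices E S \<and> pairwise disjnt M \<and> (\<forall>e\<in>delete_vertices E S. e \<inter> \<Union>M \<noteq> {})"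
    by (rule maximal_matching_iff) (use assms in \<open>auto simp: delete_vertices_def\<close>)
  moreover have "M \<subseteq> delete_vertices E S \<longleftrightarrow> M \<subseteq> E \<and> \<Union>M \<inter> S = {}"
    unfolding delete_vertices_def by blast
  moreover have "(\<forall>e\<in>delete_vertices E S. e \<inter> \<Union>M \<noteq> {}) \<longleftrightarrow> (\<forall>e\<in>E. e \<inter> (\<Union>M \<union> S) \<noteq> {})"
    unfolding delete_vertices_def Int_Un_distrib Un_empty Ball_def mem_Collect_eq by metis
  ultimately show ?thesis unfolding constrained_matchings_def by auto
qed

text \<open>The possible traces on \<open>P\<close> of a maximal matching of a larger graph. Only
  the edges in \<open>P'\<close> have to be met by the trace itself; the other edges of
  \<open>P\<close> may be met from outside.\<close>

definition partial_matchings :: "'a set set \<Rightarrow> 'a set set \<Rightarrow> 'a set \<Rightarrow> 'a set \<Rightarrow> 'a set set set" where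
  "partial_matchings P P' R Q = {L. L \<subseteq> P \<and> pairwise disjnt L \<and> \<Union>L \<inter> R = {} \<and>
     (\<forall>e\<in>P'. e \<inter> (\<Union>L \<union> R) \<noteq> {}) \<and> Q \<subseteq> \<Union>L}"

text \<open>An edge \<open>{e, d}\<close> whose end \<open>e\<close> is not in \<open>U\<close> has
  to be met at \<open>d\<close>, and likewise \<open>{c, f}\<close> at \<open>c\<close>.\<close>

definition needed :: "'a \<Rightarrow> 'a \<Rightarrow> 'a \<Rightarrow> 'a \<Rightarrow> 'a set \<Rightarrow> 'a set" where
  "needed d c e f U = (if e \<in> U then {} else {d}) \<union> (if f \<in> U then {} else {c})"

lemma glue_disjoint:
  assumes "P = P' \<union> {{e, d}, {c, f}}" "\<forall>x\<in>P'. d \<notin> x \<and> c \<notin> x \<and> x \<noteq> {}"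
    and "e \<noteq> d" "e \<noteq> c" "f \<noteq> d" "f \<noteq> c" and "\<Union>P \<inter> \<Union>H \<subseteq> {d, c}"
  shows "P \<inter> H = {}"
proof (rule ccontr)
  assume "P \<inter> H \<noteq> {}"
  then obtain x where x: "x \<in> P" "x \<in> H" by blast
  then have sub: "x \<subseteq> {d, c}" using assms(7) by blast
  from x(1) consider "x \<in> P'" | "x = {e, d}" | "x = {c, f}" unfolding assms(1) by blast
  then show False using sub assms(2-6) by cases auto
qed

text \<open>Each condition on \<open>L \<union> N\<close> splits. Edges of \<open>H\<close> see
  \<open>L\<close> only in \<open>d\<close> and \<open>c\<close>, and edges of \<open>P'\<close> do
  not see \<open>N\<close> at all. Only \<open>{e, d}\<close> and \<open>{c, f}\<close> may be met
  from either side, and they give rise to \<open>needed\<close>.\<close>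

lemma glue_iff:
  assumes P: "P = P' \<union> {{e, d}, {c, f}}" and P': "\<forall>x\<in>P'. d \<notin> x \<and> c \<notin> x \<and> x \<noteq> {}"
    and ne: "e \<noteq> d" "e \<noteq> c" "f \<noteq> d" "f \<noteq> c" "d \<noteq> c"
    and H: "{} \<notin> H" and PH: "\<Union>P \<inter> \<Union>H \<subseteq> {d, c}"
    and R: "R \<inter> (\<Union>H \<union> {d, c}) = {}" and Q: "Q \<inter> \<Union>H = {}"
    and L: "L \<subseteq> P" and N: "N \<subseteq> H"
  shows "L \<union> N \<in> constrained_matchings (P \<union> H) R Q \<longleftrightarrow>
    L \<in> partial_matchings P P' R Q \<and>
    N \<in> constrained_matchings H ({d, c} \<inter> \<Union>L) (needed d c e f (\<Union>L \<union> R))"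
proof -
  let ?S = "{d, c} \<inter> \<Union>L"
  have nonempty: "{} \<notin> P \<union> H" using P P' H by auto
  have UL: "\<Union>L \<subseteq> \<Union>P" and UN: "\<Union>N \<subseteq> \<Union>H" using L N by auto
  have ef: "e \<notin> \<Union>H" "f \<notin> \<Union>H" using PH P ne by blast+
  \<comment> \<open>\<open>{e, d}\<close> is the only edge of \<open>P\<close> at \<open>d\<close>,
    and \<open>{c, f}\<close> the only one at \<open>c\<close>.\<close>
  have dL: "d \<in> \<Union>L \<longrightarrow> e \<in> \<Union>L" and cL: "c \<in> \<Union>L \<longrightarrow> f \<in> \<Union>L"
    using L P P' ne by blast+
  have cross: "\<Union>L \<inter> \<Union>N \<subseteq> {d, c}" using UL UN PH by blast
  have LN: "x \<noteq> y" if "x \<in> L" "y \<in> N" for x y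
    using that L N glue_disjoint[OF P P' ne(1-4) PH] by blast
  have 1: "pairwise disjnt (L \<union> N) \<longleftrightarrow> pairwise disjnt L \<and> pairwise disjnt N \<and> \<Union>N \<inter> ?S = {}"
  proof (intro iffI conjI)
    assume h: "pairwise disjnt (L \<union> N)"
    show "pairwise disjnt L" "pairwise disjnt N" by (rule pairwise_subset[OF h]; simp)+
    show "\<Union>N \<inter> ?S = {}"
    proof (rule ccontr)
      assume "\<Union>N \<inter> ?S \<noteq> {}"
      then obtain v x y where "v \<in> x" "v \<in> y" "x \<in> L" "y \<in> N" by blast
      then show False using pairwiseD[OF h, of x y] LN[of x y] by (auto simp: disjnt_iff)
    qed
  next
    assume h: "pairwise disjnt L \<and> pairwise disjnt N \<and> \<Union>N \<inter> ?S = {}"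
    have c: "disjnt x y" if "x \<in> L" "y \<in> N" for x y
      using h cross that unfolding disjnt_def by blast
    show "pairwise disjnt (L \<union> N)"
    proof (rule pairwiseI)
      fix x y assume "x \<in> L \<union> N" "y \<in> L \<union> N" "x \<noteq> y"
      then show "disjnt x y"
        using h c[of x y] c[of y x] pairwiseD[of disjnt L x y] pairwiseD[of disjnt N x y]
        by (auto simp: disjnt_sym)
    qed
  qed
  have HL: "\<Union>H \<inter> \<Union>L \<subseteq> {d, c}" using UL PH by blast
  have HR: "\<Union>H \<inter> R = {}" "d \<notin> R" "c \<notin> R" using R by blast+
  have 2: "\<Union>(L \<union> N) \<inter> R = {} \<longleftrightarrow> \<Union>L \<inter> R = {}" using UN HR(1) unfolding Union_Un_distrib by blast
  have 3: "x \<inter> (\<Union>(L \<union> N) \<union> R) = x \<inter> (\<Union>N \<union> ?S)" if "x \<in> H" for x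
  proof -
    have "x \<inter> (l \<union> n \<union> r) = x \<inter> (n \<union> {d, c} \<inter> l)"
      if "x \<subseteq> h" "h \<inter> l \<subseteq> {d, c}" "h \<inter> r = {}" for l n r h
      using that by blast
    from this[OF _ HL HR(1)] that show ?thesis unfolding Union_Un_distrib by blast
  qed
  have 4: "x \<inter> (\<Union>(L \<union> N) \<union> R) = x \<inter> (\<Union>L \<union> R)" if "x \<in> P'" for x
  proof -
    have "x \<inter> \<Union>N \<subseteq> {d, c}" using that UN PH unfolding P by blast
    then have "x \<inter> \<Union>N = {}" using bspec[OF P' that] by blast
    then show ?thesis unfolding Union_Un_distrib by blast
  qed
  have meets_pair: "{x, y} \<inter> A \<noteq> {} \<longleftrightarrow> x \<in> A \<or> y \<in> A" for x y A by auto
  have efN: "e \<notin> \<Union>N" "f \<notin> \<Union>N" using UN ef by blast+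
  \<comment> \<open>By \<open>dL\<close>, covering \<open>d\<close> from \<open>L\<close> entails
    covering \<open>e\<close>; moreover \<open>N\<close> cannot reach \<open>e\<close>, and
    \<open>R\<close> misses \<open>d\<close>. So the edge is met either at \<open>e\<close> from
    this side or at \<open>d\<close> by \<open>N\<close>.\<close>
  have 5: "{e, d} \<inter> (\<Union>(L \<union> N) \<union> R) \<noteq> {} \<longleftrightarrow> (e \<notin> \<Union>L \<union> R \<longrightarrow> d \<in> \<Union>N)"
    unfolding meets_pair Union_Un_distrib Un_iff using dL HR(2) efN(1) by argo
  have 6: "{c, f} \<inter> (\<Union>(L \<union> N) \<union> R) \<noteq> {} \<longleftrightarrow> (f \<notin> \<Union>L \<union> R \<longrightarrow> c \<in> \<Union>N)"
    unfolding meets_pair Union_Un_distrib Un_iff using cL HR(3) efN(2) by argo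
  have 7: "Q \<subseteq> \<Union>(L \<union> N) \<longleftrightarrow> Q \<subseteq> \<Union>L" using UN Q unfolding Union_Un_distrib by blast
  have 8: "needed d c e f (\<Union>L \<union> R) \<subseteq> \<Union>N \<longleftrightarrow>
      (e \<notin> \<Union>L \<union> R \<longrightarrow> d \<in> \<Union>N) \<and> (f \<notin> \<Union>L \<union> R \<longrightarrow> c \<in> \<Union>N)"
    unfolding needed_def by auto
  have 9: "(\<forall>x\<in>P \<union> H. x \<inter> (\<Union>(L \<union> N) \<union> R) \<noteq> {}) \<longleftrightarrow>
     (\<forall>x\<in>P'. x \<inter> (\<Union>L \<union> R) \<noteq> {}) \<and> (\<forall>x\<in>H. x \<inter> (\<Union>N \<union> ?S) \<noteq> {}) \<and>
      needed d c e f (\<Union>L \<union> R) \<subseteq> \<Union>N"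
  proof -
    have "(\<forall>x\<in>P \<union> H. x \<inter> (\<Union>(L \<union> N) \<union> R) \<noteq> {}) \<longleftrightarrow> (\<forall>x\<in>P'. x \<inter> (\<Union>(L \<union> N) \<union> R) \<noteq> {}) \<and>
       ({e, d} \<inter> (\<Union>(L \<union> N) \<union> R) \<noteq> {} \<and> {c, f} \<inter> (\<Union>(L \<union> N) \<union> R) \<noteq> {}) \<and>
       (\<forall>x\<in>H. x \<inter> (\<Union>(L \<union> N) \<union> R) \<noteq> {})"
      unfolding P ball_Un by (simp only: ball_simps simp_thms conj_assoc)
    then show ?thesis
      unfolding 8 5 6 by (simp only: 3 4 cong: ball_cong) argo
  qed
  show ?thesis
    unfolding constrained_matchings_iff[OF nonempty] constrained_matchings_iff[OF H]
      partial_matchings_def mem_Collect_eq 1 2 7 9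
    using L N Un_mono[OF L N] by argo
qed

text \<open>\<open>P\<close> and \<open>H\<close> have no common edge, so a matching of the union is
  recovered from its parts in \<open>P\<close> and in \<open>H\<close>.\<close>

lemma glue_bij:
  assumes P: "P = P' \<union> {{e, d}, {c, f}}" and P': "\<forall>x\<in>P'. d \<notin> x \<and> c \<notin> x \<and> x \<noteq> {}"
    and ne: "e \<noteq> d" "e \<noteq> c" "f \<noteq> d" "f \<noteq> c" "d \<noteq> c"
    and H: "{} \<notin> H" and PH: "\<Union>P \<inter> \<Union>H \<subseteq> {d, c}"
    and R: "R \<inter> (\<Union>H \<union> {d, c}) = {}" and Q: "Q \<inter> \<Union>H = {}"
  shows "bij_betw (\<lambda>(L, N). L \<union> N)
    (SIGMA L : partial_matchings P P' R Q.
       constrained_matchings H ({d, c} \<inter> \<Union>L) (needed d c e f (\<Union>L \<union> R)))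
    (constrained_matchings (P \<union> H) R Q)"
proof -
  note iff = glue_iff[OF assms]
  have dis: "x \<notin> H" if "x \<in> P" for x
    using that glue_disjoint[OF P P' ne(1-4) PH] by blast
  have nonempty: "{} \<notin> P \<union> H" using P P' H by auto
  have sub: "L \<subseteq> P" "N \<subseteq> H" if "L \<in> partial_matchings P P' R Q" "N \<in> constrained_matchings H S T" for L N S T
    using that constrained_matchings_iff[OF H] by (auto simp: partial_matchings_def)
  show ?thesis
  proof (rule bij_betw_byWitness[where f' = "\<lambda>M. (M \<inter> P, M \<inter> H)"])
    show "\<forall>a\<in>SIGMA L : partial_matchings P P' R Q.
       constrained_matchings H ({d, c} \<inter> \<Union>L) (needed d c e f (\<Union>L \<union> R)).
        ((case a of (L, N) \<Rightarrow> L \<union> N) \<inter> P, (case a of (L, N) \<Rightarrow> L \<union> N) \<inter> H) = a"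
      using sub dis by fastforce
    have MPH: "M \<subseteq> P \<union> H" if "M \<in> constrained_matchings (P \<union> H) R Q" for M
      using that unfolding constrained_matchings_iff[OF nonempty] by (rule conjunct1)
    show "\<forall>M\<in>constrained_matchings (P \<union> H) R Q. (case (M \<inter> P, M \<inter> H) of (L, N) \<Rightarrow> L \<union> N) = M"
      using MPH by (simp add: Int_Un_distrib[symmetric] Int_absorb2)
    show "(\<lambda>(L, N). L \<union> N) ` (SIGMA L : partial_matchings P P' R Q.
       constrained_matchings H ({d, c} \<inter> \<Union>L) (needed d c e f (\<Union>L \<union> R)))
      \<subseteq> constrained_matchings (P \<union> H) R Q"
      by (auto simp: iff[OF sub])
    show "(\<lambda>M. (M \<inter> P, M \<inter> H)) ` constrained_matchings (P \<union> H) R Q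
      \<subseteq> (SIGMA L : partial_matchings P P' R Q.
       constrained_matchings H ({d, c} \<inter> \<Union>L) (needed d c e f (\<Union>L \<union> R)))"
    proof
      fix a assume "a \<in> (\<lambda>M. (M \<inter> P, M \<inter> H)) ` constrained_matchings (P \<union> H) R Q"
      then obtain M where M: "M \<in> constrained_matchings (P \<union> H) R Q" "a = (M \<inter> P, M \<inter> H)" by blast
      then have "M = (M \<inter> P) \<union> (M \<inter> H)" using MPH[OF M(1)] by blast
      then show "a \<in> (SIGMA L : partial_matchings P P' R Q.
          constrained_matchings H ({d, c} \<inter> \<Union>L) (needed d c e f (\<Union>L \<union> R)))"
        using iff[of "M \<inter> P" "M \<inter> H"] M by simp
    qed
  qed
qed

text \<open>Transport along a renaming that is injective on the vertices involved. It carries counts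
  from the standard polygon with vertices \<open>Vx j\<close> to an arbitrary one.\<close>

lemma partial_matchings_image:
  assumes inj: "inj_on \<phi> A" and sub: "\<Union>P \<subseteq> A" "\<Union>P' \<subseteq> A" "R \<subseteq> A" "Q \<subseteq> A"
  shows "bij_betw (image (image \<phi>)) (partial_matchings P P' R Q)
    (partial_matchings (image \<phi> ` P) (image \<phi> ` P') (\<phi> ` R) (\<phi> ` Q))"
proof -
  have iff: "image \<phi> ` L \<in> partial_matchings (image \<phi> ` P) (image \<phi> ` P') (\<phi> ` R) (\<phi> ` Q) \<longleftrightarrow>
      L \<in> partial_matchings P P' R Q" if L: "L \<subseteq> P" for L
  proof -
    have UL: "\<Union>L \<subseteq> A" using L sub by blast
    have U: "\<Union>(image \<phi> ` L) = \<phi> ` \<Union>L" by blast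
    have meet: "\<phi> ` X \<inter> \<phi> ` Y = {} \<longleftrightarrow> X \<inter> Y = {}" if "X \<subseteq> A" "Y \<subseteq> A" for X Y
      using inj_on_image_Int[OF inj that] by (metis image_is_empty)
    have "pairwise disjnt (image \<phi> ` L) \<longleftrightarrow> pairwise disjnt L"
    proof -
      have xA: "x \<subseteq> A" if "x \<in> L" for x using that UL by blast
      have eq: "\<phi> ` x = \<phi> ` y \<longleftrightarrow> x = y" "\<phi> ` x \<inter> \<phi> ` y = {} \<longleftrightarrow> x \<inter> y = {}" if "x \<in> L" "y \<in> L" for x y
        using inj_on_image_eq_iff[OF inj xA[OF that(1)] xA[OF that(2)]]
          meet[OF xA[OF that(1)] xA[OF that(2)]] by simp_all
      then show ?thesis
        unfolding pairwise_image pairwise_def disjnt_def by simp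
    qed
    moreover have "\<phi> ` \<Union>L \<inter> \<phi> ` R = {} \<longleftrightarrow> \<Union>L \<inter> R = {}" using meet UL sub by blast
    moreover have "(\<forall>x\<in>image \<phi> ` P'. x \<inter> (\<phi> ` \<Union>L \<union> \<phi> ` R) \<noteq> {}) \<longleftrightarrow> (\<forall>x\<in>P'. x \<inter> (\<Union>L \<union> R) \<noteq> {})"
    proof -
      have "\<phi> ` x \<inter> (\<phi> ` \<Union>L \<union> \<phi> ` R) = {} \<longleftrightarrow> x \<inter> (\<Union>L \<union> R) = {}" if "x \<in> P'" for x
        unfolding image_Un[symmetric] by (rule meet) (use that UL sub in blast)+
      then show ?thesis by (simp only: ball_simps cong: ball_cong)
    qed
    moreover have "\<phi> ` Q \<subseteq> \<phi> ` \<Union>L \<longleftrightarrow> Q \<subseteq> \<Union>L"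
      using inj_on_image_subset_iff[OF inj sub(4) UL] .
    moreover have "image \<phi> ` L \<subseteq> image \<phi> ` P" using L by blast
    ultimately show ?thesis unfolding partial_matchings_def mem_Collect_eq U using L by argo
  qed
  show ?thesis
    unfolding bij_betw_def
  proof
    have inj2: "inj_on (image (image \<phi>)) (Pow (Pow A))"
      by (intro inj_on_image_Pow inj)
    have "P \<subseteq> Pow A" using sub(1) by blast
    moreover have "partial_matchings P P' R Q \<subseteq> Pow P" by (auto simp only: partial_matchings_def)
    ultimately show "inj_on (image (image \<phi>)) (partial_matchings P P' R Q)"
      using inj_on_subset[OF inj2] Pow_mono by (meson order_trans)
    show "image (image \<phi>) ` partial_matchings P P' R Q =
        partial_matchings (image \<phi> ` P) (image \<phi> ` P') (\<phi> ` R) (\<phi> ` Q)" (is "?A = ?B")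
    proof
      show "?A \<subseteq> ?B"
      proof (rule image_subsetI)
        fix L assume "L \<in> partial_matchings P P' R Q"
        moreover from this have "L \<subseteq> P" by (simp add: partial_matchings_def)
        ultimately show "image \<phi> ` L \<in> ?B" using iff by simp
      qed
      show "?B \<subseteq> ?A"
      proof
        fix X assume X: "X \<in> ?B"
        then have "X \<subseteq> image \<phi> ` P" by (simp add: partial_matchings_def)
        then obtain L where "L \<subseteq> P" "X = image \<phi> ` L" by (meson subset_image_iff)
        then show "X \<in> ?A" using iff[of L] X by auto
      qed
    qed
  qed
qed

section \<open>The transfer matrices\<close>

text \<open>Together with \<open>rows_required\<close>, the nine rows run through all combinations
  in which each of \<open>a\<close> and \<open>b\<close> is removed, required or free.\<close>

definition rows_removed :: "'a \<Rightarrow> 'a \<Rightarrow> nat \<Rightarrow> 'a set" where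
  "rows_removed a b x = [{}, {a}, {b}, {a, b}, {}, {a}, {b}, {}, {}] ! x"

definition rows_required :: "'a \<Rightarrow> 'a \<Rightarrow> nat \<Rightarrow> 'a set" where
  "rows_required a b x = [{}, {}, {}, {}, {a, b}, {b}, {a}, {a}, {b}] ! x"

definition row_count :: "'a set set \<Rightarrow> 'a \<Rightarrow> 'a \<Rightarrow> nat \<Rightarrow> nat" where
  "row_count E a b x = card (constrained_matchings E (rows_removed a b x) (rows_required a b x))"

text \<open>The column conditions as functions of four truth values alone, so that they can be
  evaluated in a polygon without pendant edges.\<close>

definition column_test :: "bool \<Rightarrow> bool \<Rightarrow> bool \<Rightarrow> bool \<Rightarrow> nat \<Rightarrow> bool" where
  "column_test k1 e k2 f y =
     [k1 \<and> e \<and> k2 \<and> f, k2 \<and> f \<and> \<not> k1, k1 \<and> e \<and> \<not> k2, \<not> k1 \<and> \<not> k2, \<not> e \<and> \<not> f,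
      \<not> k1 \<and> \<not> f, \<not> k2 \<and> \<not> e, k2 \<and> f \<and> \<not> e, k1 \<and> e \<and> \<not> f] ! y"

lemma less_9_cases:
  fixes y :: nat
  assumes "y < 9"
  obtains "y = 0" | "y = 1" | "y = 2" | "y = 3" | "y = 4" | "y = 5" | "y = 6" | "y = 7" | "y = 8"
  using assms by linarith

lemma rows_subset:
  assumes "x < 9"
  shows "rows_removed a b x \<subseteq> {a, b}" "rows_required a b x \<subseteq> {a, b}"
  using assms by (cases rule: less_9_cases; simp add: rows_removed_def rows_required_def)+

lemma rows_image:
  assumes "x < 9"
  shows "\<phi> ` rows_removed a b x = rows_removed (\<phi> a) (\<phi> b) x"
    "\<phi> ` rows_required a b x = rows_required (\<phi> a) (\<phi> b) x"
  using assms by (cases rule: less_9_cases; simp add: rows_removed_def rows_required_def)+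

lemma row_matchings_eq:
  "row_matchings m i x =
    constrained_matchings (Jprime m i) (rows_removed (Vx 1) (Vx 0) x) (rows_required (Vx 1) (Vx 0) x)"
  by (simp add: row_matchings_def constrained_matchings_def row_removed_def row_required_def
      rows_removed_def rows_required_def Let_def)

text \<open>This is why rows and columns share one index set: column \<open>y\<close> describes
  exactly the situation that row \<open>y\<close> imposes on what lies behind \<open>dc\<close>. If
  \<open>k1\<close> fails, \<open>d\<close> is already covered and is removed; if \<open>e\<close>
  fails, \<open>d\<close> is required. The same holds for \<open>c\<close> with \<open>k2\<close>
  and \<open>f\<close>.\<close>

lemma column_test_rows:
  assumes "y < 9" "column_test k1 e k2 f y" "k1 \<or> e" "k2 \<or> f"
  shows "rows_removed d c y = (if k1 then {} else {d}) \<union> (if k2 then {} else {c})"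
    "rows_required d c y = (if e then {} else {d}) \<union> (if f then {} else {c})"
  using assms
  by (cases rule: less_9_cases; auto simp: rows_removed_def rows_required_def column_test_def)+

text \<open>Under \<open>k1 \<or> e\<close> and \<open>k2 \<or> f\<close> each of the two pairs has
  three possible values, and the conditions separate the nine combinations.\<close>

lemma column_test_unique:
  assumes "y < 9" "z < 9" "column_test k1 e k2 f y" "column_test k1 e k2 f z" "k1 \<or> e" "k2 \<or> f"
  shows "y = z"
  using assms(1)
proof (cases rule: less_9_cases)
qed (use assms(2) in \<open>cases rule: less_9_cases; use assms(3-) in \<open>simp add: column_test_def\<close>\<close>)+

lemma column_test_exists:
  assumes "k1 \<or> e" "k2 \<or> f"
  obtains y where "y < 9" "column_test k1 e k2 f y"
proof -
  have "column_test k1 e k2 f 0 \<or> column_test k1 e k2 f 1 \<or> column_test k1 e k2 f 2 \<or>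
    column_test k1 e k2 f 3 \<or> column_test k1 e k2 f 4 \<or> column_test k1 e k2 f 5 \<or>
    column_test k1 e k2 f 6 \<or> column_test k1 e k2 f 7 \<or> column_test k1 e k2 f 8"
    using assms unfolding column_test_def by simp argo
  then show ?thesis using that[of 0] that[of 1] that[of 2] that[of 3] that[of 4] that[of 5]
      that[of 6] that[of 7] that[of 8] by auto
qed

lemma column_condition_eq:
  assumes "y < 9"
  shows "column_condition m i U y = column_test (K1 \<in> U) (Vx i \<in> U) (K2 \<in> U) (Vx ((i + 3) mod m) \<in> U) y"
  using assms by (cases rule: less_9_cases) (simp_all add: column_condition_def column_test_def Let_def)

lemma assigned_eq:
  assumes "y < 9" "K1 \<in> U \<or> Vx i \<in> U" "K2 \<in> U \<or> Vx ((i + 3) mod m) \<in> U"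
  shows "assigned m i U y = column_test (K1 \<in> U) (Vx i \<in> U) (K2 \<in> U) (Vx ((i + 3) mod m) \<in> U) y"
  unfolding assigned_def column_condition_eq[OF assms(1)]
  using column_test_unique[OF assms(1) _ _ _ assms(2,3)] column_condition_eq[of _ m i U] assms(1)
  by (metis less_trans nat_neq_iff)

definition path_edges :: "'a list \<Rightarrow> nat \<Rightarrow> 'a set set" where
  "path_edges p i = cyc_edge p ` ({..<length p} - {i + 1})"

text \<open>Edge \<open>i + 1\<close> of the polygon is \<open>dc\<close>, where the path is cut
  open. The edges \<open>i\<close> and \<open>i + 2\<close> end in \<open>d\<close> and
  \<open>c\<close> and can be met from behind the cut; those that remain must be met within the
  polygon.\<close>

definition inner_edges :: "'a list \<Rightarrow> nat \<Rightarrow> 'a set set" where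
  "inner_edges p i = cyc_edge p ` ({..<length p} - {i, i + 1, i + 2})"

abbreviation path_matchings :: "'a list \<Rightarrow> nat \<Rightarrow> 'a set \<Rightarrow> 'a set \<Rightarrow> 'a set set set" where
  "path_matchings p i \<equiv> partial_matchings (path_edges p i) (inner_edges p i)"

text \<open>The pendant edge at \<open>d\<close> is used exactly when \<open>L\<close> leaves
  \<open>d\<close> uncovered, so \<open>d \<notin> \<Union>L\<close> takes the place of the truth
  value \<open>k1\<close>; likewise \<open>c\<close> for \<open>k2\<close>.\<close>

definition slot_test :: "'a list \<Rightarrow> nat \<Rightarrow> 'a set \<Rightarrow> 'a set set \<Rightarrow> nat \<Rightarrow> bool" where
  "slot_test p i R L = column_test (p ! (i + 1) \<notin> \<Union>L) (p ! i \<in> \<Union>L \<union> R)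
     (p ! (i + 2) \<notin> \<Union>L) (p ! ((i + 3) mod length p) \<in> \<Union>L \<union> R)"

text \<open>The polygon is entered through its edge 0, with \<open>b = p ! 0\<close> and
  \<open>a = p ! 1\<close>, and left through edge \<open>i + 1\<close>. The bounds on
  \<open>i\<close> keep the two edges disjoint.\<close>

locale polygon_slot =
  fixes p :: "'a list" and i :: nat
  assumes distinct_p: "distinct p" and i_pos: "1 \<le> i" and i_le: "i + 3 \<le> length p"
begin

abbreviation "d \<equiv> p ! (i + 1)"
abbreviation "c \<equiv> p ! (i + 2)"
abbreviation "e \<equiv> p ! i"
abbreviation "f \<equiv> p ! ((i + 3) mod length p)"

lemma p_nonempty: "p \<noteq> []"
  using i_le by auto

lemma f_index: "(i + 3) mod length p = (if i + 3 = length p then 0 else i + 3)"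
  using i_le by auto

lemma distinct_vertices: "e \<noteq> d" "e \<noteq> c" "f \<noteq> d" "f \<noteq> c" "d \<noteq> c"
  unfolding f_index using distinct_p i_pos i_le p_nonempty by (auto simp: nth_eq_iff_index_eq)

lemma ends_not_slot: "p ! 0 \<noteq> d" "p ! 0 \<noteq> c" "p ! 1 \<noteq> d" "p ! 1 \<noteq> c"
  using distinct_p i_pos i_le p_nonempty by (auto simp: nth_eq_iff_index_eq)

lemma path_edges_split: "path_edges p i = inner_edges p i \<union> {{e, d}, {c, f}}"
proof -
  have "{..<length p} - {i + 1} = ({..<length p} - {i, i + 1, i + 2}) \<union> {i, i + 2}"
    using i_le by auto
  moreover have "cyc_edge p i = {e, d}" using i_le by (simp add: cyc_edge_def)
  moreover have "cyc_edge p (i + 2) = {c, f}" by (simp add: cyc_edge_def numeral_3_eq_3)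
  ultimately show ?thesis unfolding path_edges_def inner_edges_def by (simp only: image_Un) simp
qed

lemma inner_edges_avoid: "\<forall>x\<in>inner_edges p i. d \<notin> x \<and> c \<notin> x \<and> x \<noteq> {}"
proof
  fix x assume "x \<in> inner_edges p i"
  then obtain j where j: "j < length p" "j \<noteq> i" "j \<noteq> i + 1" "j \<noteq> i + 2" "x = cyc_edge p j"
    unfolding inner_edges_def by blast
  have s: "Suc j mod length p = (if Suc j = length p then 0 else Suc j)"
    using j(1) by (simp add: mod_Suc)
  show "d \<notin> x \<and> c \<notin> x \<and> x \<noteq> {}"
    unfolding j(5) cyc_edge_def s using j distinct_p i_le p_nonempty by (auto simp: nth_eq_iff_index_eq)
qed

lemma path_edges_subset: "\<Union>(path_edges p i) \<subseteq> set p" "\<Union>(inner_edges p i) \<subseteq> set p"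
  unfolding path_edges_def inner_edges_def cyc_edge_def by (auto intro!: nth_mem mod_less_divisor)

text \<open>On the path cut open at \<open>dc\<close>, the vertex \<open>d\<close> can only be
  matched to \<open>e\<close>, and \<open>c\<close> only to \<open>f\<close>.\<close>

lemma covered_slot:
  assumes "L \<in> path_matchings p i R Q"
  shows "d \<in> \<Union>L \<Longrightarrow> e \<in> \<Union>L" "c \<in> \<Union>L \<Longrightarrow> f \<in> \<Union>L"
proof -
  have "L \<subseteq> inner_edges p i \<union> {{e, d}, {c, f}}"
    using assms unfolding partial_matchings_def path_edges_split by blast
  then have L: "x \<in> inner_edges p i \<or> x = {e, d} \<or> x = {c, f}" if "x \<in> L" for x
    using that by blast
  show "e \<in> \<Union>L" if "d \<in> \<Union>L"
  proof -
    obtain x where x: "x \<in> L" "d \<in> x" using \<open>d \<in> \<Union>L\<close> by (rule UnionE)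
    have "x \<notin> inner_edges p i" using bspec[OF inner_edges_avoid] x(2) by blast
    moreover have "x \<noteq> {c, f}" using x(2) distinct_vertices by (metis insertE singletonD)
    ultimately have "x = {e, d}" using L[OF x(1)] by metis
    then have "e \<in> x" by simp
    then show ?thesis using x(1) by (rule UnionI[rotated])
  qed
  show "f \<in> \<Union>L" if "c \<in> \<Union>L"
  proof -
    obtain x where x: "x \<in> L" "c \<in> x" using \<open>c \<in> \<Union>L\<close> by (rule UnionE)
    have "x \<notin> inner_edges p i" using bspec[OF inner_edges_avoid] x(2) by blast
    moreover have "x \<noteq> {e, d}" using x(2) distinct_vertices by (metis insertE singletonD)
    ultimately have "x = {c, f}" using L[OF x(1)] by metis
    then have "f \<in> x" by simp
    then show ?thesis using x(1) by (rule UnionI[rotated])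
  qed
qed

lemma slot_rows:
  assumes "L \<in> path_matchings p i R Q" "y < 9" "slot_test p i R L y"
  shows "rows_removed d c y = {d, c} \<inter> \<Union>L" "rows_required d c y = needed d c e f (\<Union>L \<union> R)"
proof -
  have "d \<notin> \<Union>L \<or> e \<in> \<Union>L \<union> R" "c \<notin> \<Union>L \<or> f \<in> \<Union>L \<union> R"
    unfolding Un_iff using covered_slot[OF assms(1)] by metis+
  note * = column_test_rows[OF assms(2) assms(3)[unfolded slot_test_def] this, of d c]
  show "rows_removed d c y = {d, c} \<inter> \<Union>L" unfolding *(1) by (simp only: Int_insert_left) simp
  show "rows_required d c y = needed d c e f (\<Union>L \<union> R)" unfolding *(2) needed_def by simp
qed

lemma slot_unique:
  assumes "L \<in> path_matchings p i R Q"
  shows "\<exists>!y. y < 9 \<and> slot_test p i R L y"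
proof -
  have *: "d \<notin> \<Union>L \<or> e \<in> \<Union>L \<union> R" "c \<notin> \<Union>L \<or> f \<in> \<Union>L \<union> R"
    unfolding Un_iff using covered_slot[OF assms(1)] by metis+
  obtain y where "y < 9" "slot_test p i R L y"
    using column_test_exists[OF *] unfolding slot_test_def by blast
  then show ?thesis
    using column_test_unique[OF _ _ _ _ *] unfolding slot_test_def by metis
qed

lemma finite_path_matchings: "finite (path_matchings p i R Q)"
proof (rule finite_subset)
  show "path_matchings p i R Q \<subseteq> Pow (path_edges p i)" by (auto simp only: partial_matchings_def)
  show "finite (Pow (path_edges p i))" by (simp add: path_edges_def)
qed

lemma slot_bij:
  assumes "{} \<notin> H" "\<Union>H \<inter> set p \<subseteq> {d, c}" "R \<subseteq> set p - {d, c}" "Q \<subseteq> set p - {d, c}"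
  shows "bij_betw (\<lambda>(L, N). L \<union> N)
    (SIGMA L : path_matchings p i R Q.
       constrained_matchings H ({d, c} \<inter> \<Union>L) (needed d c e f (\<Union>L \<union> R)))
    (constrained_matchings (path_edges p i \<union> H) R Q)"
proof (rule glue_bij[OF path_edges_split inner_edges_avoid distinct_vertices assms(1)])
  show "\<Union>(path_edges p i) \<inter> \<Union>H \<subseteq> {d, c}" using assms(2) path_edges_subset(1) by blast
  show "R \<inter> (\<Union>H \<union> {d, c}) = {}" using assms(2,3) by blast
  show "Q \<inter> \<Union>H = {}" using assms(2,4) by blast
qed

text \<open>The pairs counted by \<open>slot_bij\<close> are grouped by the state \<open>y\<close>
  of \<open>L\<close>; by \<open>slot_rows\<close> the number of completions in \<open>H\<close>
  depends on this state alone.\<close>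

lemma slot_count:
  assumes "{} \<notin> H" "\<Union>H \<inter> set p \<subseteq> {d, c}" "R \<subseteq> set p - {d, c}" "Q \<subseteq> set p - {d, c}" "finite H"
  shows "card (constrained_matchings (path_edges p i \<union> H) R Q) =
    (\<Sum>y<9. card {L \<in> path_matchings p i R Q. slot_test p i R L y} * row_count H d c y)"
proof -
  let ?X = "path_matchings p i R Q"
  have finH: "finite (constrained_matchings H S T)" for S T
  proof (rule finite_subset)
    show "constrained_matchings H S T \<subseteq> Pow H"
      using constrained_matchings_iff[OF assms(1), of _ S T] by blast
  qed (simp add: assms(5))
  have one: "card (constrained_matchings H ({d, c} \<inter> \<Union>L) (needed d c e f (\<Union>L \<union> R))) =
      (\<Sum>y<9. if slot_test p i R L y then row_count H d c y else 0)" if L: "L \<in> ?X" for L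
  proof -
    obtain y where y: "y < 9" "slot_test p i R L y" and u: "\<And>z. z < 9 \<Longrightarrow> slot_test p i R L z \<Longrightarrow> z = y"
      using slot_unique[OF L] by blast
    have "(\<Sum>z<9. if slot_test p i R L z then row_count H d c z else 0) = (\<Sum>z<9. if z = y then row_count H d c y else 0)"
    proof (rule sum.cong[OF refl])
      fix z :: nat assume "z \<in> {..<9}"
      then have "slot_test p i R L z \<longleftrightarrow> z = y" using u[of z] y by blast
      then show "(if slot_test p i R L z then row_count H d c z else 0) = (if z = y then row_count H d c y else 0)"
        by simp
    qed
    also have "\<dots> = row_count H d c y" using y by simp
    finally show ?thesis using slot_rows[OF L y] by (simp add: row_count_def)
  qed
  have "card (constrained_matchings (path_edges p i \<union> H) R Q) =
     card (SIGMA L : ?X. constrained_matchings H ({d, c} \<inter> \<Union>L) (needed d c e f (\<Union>L \<union> R)))"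
    using bij_betw_same_card[OF slot_bij[OF assms(1-4)]] by simp
  also have "\<dots> = (\<Sum>L\<in>?X. card (constrained_matchings H ({d, c} \<inter> \<Union>L) (needed d c e f (\<Union>L \<union> R))))"
    by (rule card_SigmaI) (use finite_path_matchings finH in auto)
  also have "\<dots> = (\<Sum>L\<in>?X. \<Sum>y<9. if slot_test p i R L y then row_count H d c y else 0)"
    using one by (rule sum.cong[OF refl])
  also have "\<dots> = (\<Sum>y<9. \<Sum>L\<in>?X. if slot_test p i R L y then row_count H d c y else 0)"
    by (rule sum.swap)
  also have "\<dots> = (\<Sum>y<9. card {L \<in> ?X. slot_test p i R L y} * row_count H d c y)"
    using finite_path_matchings by (intro sum.cong refl) (simp add: sum.If_cases Int_def)
  finally show ?thesis .
qed

end

section \<open>Entries of the transfer matrix as numbers of path matchings\<close>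

lemma card_filter_bij:
  assumes "bij_betw g A B" "\<And>x. x \<in> A \<Longrightarrow> P x \<longleftrightarrow> P' (g x)"
  shows "card {x \<in> A. P x} = card {y \<in> B. P' y}"
proof (rule bij_betw_same_card)
  show "bij_betw g {x \<in> A. P x} {y \<in> B. P' y}"
    using assms unfolding bij_betw_def inj_on_def by auto
qed

text \<open>The edge \<open>{k, d}\<close> must be met, and in this graph both of its ends can be
  covered only by the edge itself. So it is used unless \<open>d\<close> is removed, and the same
  holds at \<open>c\<close>.\<close>

lemma pendant_matchings:
  assumes "k \<noteq> l" "k \<noteq> d" "k \<noteq> c" "l \<noteq> d" "l \<noteq> c" "d \<noteq> c" "S \<subseteq> {d, c}" "Q \<subseteq> {d, c} - S"
  shows "constrained_matchings {{k, d}, {l, c}} S Q = {{x \<in> {{k, d}, {l, c}}. x \<inter> S = {}}}"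
    (is "_ = {?N}")
proof -
  have ne: "{} \<notin> {{k, d}, {l, c}}" by simp
  have "M \<in> constrained_matchings {{k, d}, {l, c}} S Q \<longleftrightarrow> M = ?N" for M
  proof
    assume M: "M \<in> constrained_matchings {{k, d}, {l, c}} S Q"
    then have 1: "M \<subseteq> {{k, d}, {l, c}}" "\<Union>M \<inter> S = {}"
      "{k, d} \<inter> (\<Union>M \<union> S) \<noteq> {}" "{l, c} \<inter> (\<Union>M \<union> S) \<noteq> {}"
      unfolding constrained_matchings_iff[OF ne] by simp_all
    have "{k, d} \<in> M" if "d \<notin> S"
    proof (rule ccontr)
      assume "{k, d} \<notin> M"
      then have "M \<subseteq> {{l, c}}" using 1(1) by blast
      then have "\<Union>M \<subseteq> {l, c}" by blast
      then show False using 1(3) that assms by blast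
    qed
    moreover have "{l, c} \<in> M" if "c \<notin> S"
    proof (rule ccontr)
      assume "{l, c} \<notin> M"
      then have "M \<subseteq> {{k, d}}" using 1(1) by blast
      then have "\<Union>M \<subseteq> {k, d}" by blast
      then show False using 1(4) that assms by blast
    qed
    ultimately show "M = ?N" using 1(1,2) assms(7) by auto
  next
    assume M: "M = ?N"
    have "pairwise disjnt M" unfolding M pairwise_def disjnt_def using assms(1-6) by auto
    moreover have kl: "k \<notin> S" "l \<notin> S" using assms by blast+
    have mem: "{k, d} \<in> M" if "d \<notin> S" unfolding M using kl that by simp
    have mem': "{l, c} \<in> M" if "c \<notin> S" unfolding M using kl that by simp
    have dU: "d \<in> \<Union>M" if "d \<notin> S" using mem[OF that] by (rule UnionI) simp
    have cU: "c \<in> \<Union>M" if "c \<notin> S" using mem'[OF that] by (rule UnionI) simp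
    have "d \<in> \<Union>M \<union> S" "c \<in> \<Union>M \<union> S" using dU cU by (meson UnI1 UnI2)+
    then have "{k, d} \<inter> (\<Union>M \<union> S) \<noteq> {}" "{l, c} \<inter> (\<Union>M \<union> S) \<noteq> {}" by (metis Int_iff empty_iff insertI1 insertI2)+
    moreover have "Q \<subseteq> \<Union>M"
    proof
      fix v assume "v \<in> Q"
      then have "v = d \<and> d \<notin> S \<or> v = c \<and> c \<notin> S" using assms(8) by blast
      then show "v \<in> \<Union>M" using dU cU by metis
    qed
    moreover have "M \<subseteq> {{k, d}, {l, c}}" "\<Union>M \<inter> S = {}" unfolding M by blast+
    ultimately show "M \<in> constrained_matchings {{k, d}, {l, c}} S Q"
      unfolding constrained_matchings_iff[OF ne] by (simp only: ball_simps simp_thms)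
  qed
  then show ?thesis unfolding set_eq_iff[of "constrained_matchings _ _ _"] singleton_iff by (rule allI)
qed

lemma Union_pair_iff:
  assumes "M \<subseteq> {{k, d}, {l, c}}" "k \<noteq> l" "k \<noteq> c"
  shows "k \<in> \<Union>M \<longleftrightarrow> {k, d} \<in> M"
proof
  assume "k \<in> \<Union>M"
  then obtain x where x: "x \<in> M" "k \<in> x" by (rule UnionE)
  then have "x = {k, d} \<or> x = {l, c}" using assms(1) by blast
  then show "{k, d} \<in> M" using x assms(2,3) by auto
qed (rule UnionI, auto)

lemma Jprime_eq:
  assumes "i + 3 \<le> m"
  shows "Jprime m i = path_edges (map Vx [0..<m]) i \<union> {{K1, Vx (i + 1)}, {K2, Vx (i + 2)}}"
proof -
  have edge: "cyc_edge (map Vx [0..<m]) j = {Vx j, Vx (Suc j mod m)}" if "j < m" for j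
    using that by (simp add: cyc_edge_def)
  have "{{Vx j, Vx (Suc j mod m)} | j. j < m} = cyc_edge (map Vx [0..<m]) ` {..<m}"
    using edge by auto
  moreover have "cyc_edge (map Vx [0..<m]) ` {..<m} - {{Vx (i + 1), Vx (i + 2)}} =
      cyc_edge (map Vx [0..<m]) ` ({..<m} - {i + 1})"
  proof -
    have "cyc_edge (map Vx [0..<m]) j = {Vx (i + 1), Vx (i + 2)} \<longleftrightarrow> j = i + 1" if "j < m" for j
    proof -
      have s: "Suc j mod m = (if Suc j = m then 0 else Suc j)"
        using that by (simp add: mod_Suc)
      show ?thesis unfolding edge[OF that] s using assms by (auto simp: doubleton_eq_iff)
    qed
    then show ?thesis by auto
  qed
  ultimately show ?thesis unfolding Jprime_def path_edges_def by simp
qed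

text \<open>With the two pendant edges as \<open>H\<close>, every \<open>L\<close> has the single
  completion \<open>N L\<close>. So the row matchings correspond to the path matchings, and the
  assigned column of \<open>L \<union> N L\<close> is the state of \<open>L\<close>.\<close>

lemma T_mat_entry:
  assumes "1 \<le> i" "i + 3 \<le> m" "x < 9" "y < 9"
  shows "T_mat m i $$ (x, y) = card {L \<in> path_matchings (map Vx [0..<m]) i
      (rows_removed (Vx 1) (Vx 0) x) (rows_required (Vx 1) (Vx 0) x).
    slot_test (map Vx [0..<m]) i (rows_removed (Vx 1) (Vx 0) x) L y}"
proof -
  define p where "p = map Vx [0..<m]"
  have len: "length p = m" and nth: "\<And>j. j < m \<Longrightarrow> p ! j = Vx j" by (auto simp: p_def)
  interpret polygon_slot p i
    using assms by unfold_locales (auto simp: p_def distinct_map inj_on_def)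
  define H where "H = {{K1, d}, {K2, c}}"
  define R where "R = rows_removed (Vx 1) (Vx 0) x"
  define Q where "Q = rows_required (Vx 1) (Vx 0) x"
  define N where "N L = {x \<in> H. x \<inter> ({d, c} \<inter> \<Union>L) = {}}" for L
  have dc: "d = Vx (i + 1)" "c = Vx (i + 2)" "e = Vx i" "f = Vx ((i + 3) mod m)"
    using assms by (auto simp: nth len)
  have K: "K1 \<notin> set p" "K2 \<notin> set p" by (auto simp: p_def)
  have sub: "R \<subseteq> set p - {d, c}" "Q \<subseteq> set p - {d, c}"
  proof -
    have "{Vx 1, Vx 0} \<subseteq> set p - {d, c}" using assms dc by (auto simp: p_def)
    then show "R \<subseteq> set p - {d, c}" "Q \<subseteq> set p - {d, c}"
      unfolding R_def Q_def using rows_subset[OF assms(3), of "Vx 1" "Vx 0"] by (meson order_trans)+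
  qed
  have Hp: "\<Union>H \<inter> set p \<subseteq> {d, c}" unfolding H_def using K by auto
  have neH: "{} \<notin> H" by (simp add: H_def)
  let ?X = "path_matchings p i R Q"
  have single: "constrained_matchings H ({d, c} \<inter> \<Union>L) (needed d c e f (\<Union>L \<union> R)) = {N L}"
    if "L \<in> ?X" for L
    unfolding H_def N_def
  proof (rule pendant_matchings)
    show "needed d c e f (\<Union>L \<union> R) \<subseteq> {d, c} - {d, c} \<inter> \<Union>L"
    proof -
      have "d \<notin> \<Union>L" if "e \<notin> \<Union>L \<union> R" using covered_slot(1)[OF \<open>L \<in> ?X\<close>] that by (meson UnI1)
      moreover have "c \<notin> \<Union>L" if "f \<notin> \<Union>L \<union> R" using covered_slot(2)[OF \<open>L \<in> ?X\<close>] that by (meson UnI1)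
      ultimately show ?thesis unfolding needed_def by simp
    qed
  qed (use dc distinct_vertices in auto)
  have b1: "bij_betw (\<lambda>(L, N). L \<union> N) (SIGMA L : ?X. {N L}) (constrained_matchings (path_edges p i \<union> H) R Q)"
  proof -
    have "(SIGMA L : ?X. constrained_matchings H ({d, c} \<inter> \<Union>L) (needed d c e f (\<Union>L \<union> R)))
        = (SIGMA L : ?X. {N L})"
      by (rule Sigma_cong[OF refl single])
    then show ?thesis using slot_bij[OF neH Hp sub] by metis
  qed
  have b2: "bij_betw (\<lambda>L. (L, N L)) ?X (SIGMA L : ?X. {N L})"
    unfolding bij_betw_def inj_on_def by auto
  have "bij_betw ((\<lambda>(L, N). L \<union> N) \<circ> (\<lambda>L. (L, N L))) ?X
      (constrained_matchings (path_edges p i \<union> H) R Q)"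
    by (rule bij_betw_trans[OF b2 b1])
  moreover have "constrained_matchings (path_edges p i \<union> H) R Q = row_matchings m i x"
    unfolding row_matchings_eq Jprime_eq[OF assms(2)] R_def Q_def H_def dc p_def[symmetric] ..
  ultimately have bij: "bij_betw (\<lambda>L. L \<union> N L) ?X (row_matchings m i x)"
    by (simp add: comp_def)
  have test: "slot_test p i R L y \<longleftrightarrow> assigned m i (\<Union>(L \<union> N L) \<union> R) y" if L: "L \<in> ?X" for L
  proof -
    have LP: "\<Union>L \<subseteq> set p"
    proof -
      have "L \<subseteq> path_edges p i" using L by (simp add: partial_matchings_def)
      then show ?thesis using path_edges_subset(1) by blast
    qed
    have neqs: "e \<noteq> K1" "e \<noteq> K2" "f \<noteq> K1" "f \<noteq> K2" "d \<noteq> K1" "d \<noteq> K2" "c \<noteq> K1" "c \<noteq> K2"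
      unfolding dc by simp_all
    have NH: "N L \<subseteq> {{K1, d}, {K2, c}}" unfolding N_def H_def by blast
    then have "\<Union>(N L) \<subseteq> {K1, d, K2, c}" by blast
    moreover have "e \<notin> {K1, d, K2, c}" "f \<notin> {K1, d, K2, c}" using neqs distinct_vertices by simp_all
    ultimately have ef: "e \<notin> \<Union>(N L)" "f \<notin> \<Union>(N L)" by (metis subsetD)+
    have "{K1, d} \<inter> ({d, c} \<inter> A) = {} \<longleftrightarrow> d \<notin> A" "{K2, c} \<inter> ({d, c} \<inter> A) = {} \<longleftrightarrow> c \<notin> A" for A
      using neqs by auto
    then have "{K1, d} \<in> N L \<longleftrightarrow> d \<notin> \<Union>L" "{K2, c} \<in> N L \<longleftrightarrow> c \<notin> \<Union>L"
      unfolding N_def H_def mem_Collect_eq by (simp_all only: insert_iff simp_thms)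
    moreover have "K1 \<in> \<Union>(N L) \<longleftrightarrow> {K1, d} \<in> N L" "K2 \<in> \<Union>(N L) \<longleftrightarrow> {K2, c} \<in> N L"
      using Union_pair_iff[OF NH] Union_pair_iff[OF NH[unfolded insert_commute[of "{K1, d}"]]] neqs
      by simp_all
    ultimately have "K1 \<in> \<Union>(N L) \<longleftrightarrow> d \<notin> \<Union>L" "K2 \<in> \<Union>(N L) \<longleftrightarrow> c \<notin> \<Union>L"
      by metis+
    then have mem: "K1 \<in> \<Union>(L \<union> N L) \<union> R \<longleftrightarrow> d \<notin> \<Union>L" "K2 \<in> \<Union>(L \<union> N L) \<union> R \<longleftrightarrow> c \<notin> \<Union>L"
      "Vx i \<in> \<Union>(L \<union> N L) \<union> R \<longleftrightarrow> e \<in> \<Union>L \<union> R"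
      "Vx ((i + 3) mod m) \<in> \<Union>(L \<union> N L) \<union> R \<longleftrightarrow> f \<in> \<Union>L \<union> R"
      using LP K sub(1) ef unfolding dc(3,4)[symmetric] Union_Un_distrib Un_iff by (meson DiffD1 subsetD)+
    have "assigned m i (\<Union>(L \<union> N L) \<union> R) y = column_test (d \<notin> \<Union>L) (e \<in> \<Union>L \<union> R) (c \<notin> \<Union>L) (f \<in> \<Union>L \<union> R) y"
      unfolding mem[symmetric]
    proof (rule assigned_eq[OF assms(4)])
      show "K1 \<in> \<Union>(L \<union> N L) \<union> R \<or> Vx i \<in> \<Union>(L \<union> N L) \<union> R"
        unfolding mem using covered_slot(1)[OF L] by (meson UnI1)
      show "K2 \<in> \<Union>(L \<union> N L) \<union> R \<or> Vx ((i + 3) mod m) \<in> \<Union>(L \<union> N L) \<union> R"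
        unfolding mem using covered_slot(2)[OF L] by (meson UnI1)
    qed
    then show ?thesis by (simp only: slot_test_def len)
  qed
  have "T_mat m i $$ (x, y) = card {W \<in> row_matchings m i x. assigned m i (\<Union>W \<union> R) y}"
    using assms(3,4) by (simp add: T_mat_def R_def row_removed_def rows_removed_def Let_def)
  also have "\<dots> = card {L \<in> ?X. slot_test p i R L y}"
    by (rule card_filter_bij[symmetric, OF bij]) (rule test)
  finally show ?thesis unfolding p_def R_def Q_def .
qed

lemma path_edges_map:
  "path_edges (map \<phi> p) i = image \<phi> ` path_edges p i" "inner_edges (map \<phi> p) i = image \<phi> ` inner_edges p i"
proof -
  have "cyc_edge (map \<phi> p) j = \<phi> ` cyc_edge p j" if "j < length p" for j
  proof -
    have "Suc j mod length p < length p" using that by (intro mod_less_divisor) auto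
    then show ?thesis using that by (simp add: cyc_edge_def)
  qed
  then show "path_edges (map \<phi> p) i = image \<phi> ` path_edges p i"
    "inner_edges (map \<phi> p) i = image \<phi> ` inner_edges p i"
    unfolding path_edges_def inner_edges_def image_image length_map by (intro image_cong refl; simp)+
qed

context polygon_slot
begin

lemma T_mat_entry_polygon:
  assumes "x < 9" "y < 9"
  shows "T_mat (length p) i $$ (x, y) = card {L \<in> path_matchings p i (rows_removed (p ! 1) (p ! 0) x)
      (rows_required (p ! 1) (p ! 0) x). slot_test p i (rows_removed (p ! 1) (p ! 0) x) L y}"
proof -
  define m where "m = length p"
  define q where "q = map Vx [0..<m]"
  \<comment> \<open>The value at \<open>K1\<close> and \<open>K2\<close> is a dummy: these vertices
    lie outside \<open>set q\<close>, where injectivity is needed.\<close>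
  define \<phi> where "\<phi> v = (case v of Vx j \<Rightarrow> p ! j | _ \<Rightarrow> p ! 0)" for v
  have pq: "map \<phi> q = p" by (rule nth_equalityI) (auto simp: q_def m_def \<phi>_def)
  have inj: "inj_on \<phi> (set q)"
    using distinct_p by (auto simp: inj_on_def q_def \<phi>_def m_def nth_eq_iff_index_eq)
  have len: "length q = m" by (simp add: q_def)
  interpret q: polygon_slot q i
    using i_pos i_le by unfold_locales (auto simp: q_def m_def distinct_map inj_on_def)
  define R where "R = rows_removed (Vx 1) (Vx 0) x"
  define Q where "Q = rows_required (Vx 1) (Vx 0) x"
  have "{Vx 1, Vx 0} \<subseteq> set q" using i_le p_nonempty by (auto simp: q_def m_def intro!: imageI)
  then have sub: "R \<subseteq> set q" "Q \<subseteq> set q"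
    unfolding R_def Q_def using rows_subset[OF assms(1), of "Vx 1" "Vx 0"] by (meson order_trans)+
  have RQ: "\<phi> ` R = rows_removed (p ! 1) (p ! 0) x" "\<phi> ` Q = rows_required (p ! 1) (p ! 0) x"
    unfolding R_def Q_def rows_image[OF assms(1)] by (simp_all add: \<phi>_def)
  have bij: "bij_betw (image (image \<phi>)) (path_matchings q i R Q) (path_matchings p i (\<phi> ` R) (\<phi> ` Q))"
    using partial_matchings_image[OF inj q.path_edges_subset sub]
    unfolding path_edges_map[symmetric] pq .
  have test: "slot_test q i R L y \<longleftrightarrow> slot_test p i (\<phi> ` R) (image \<phi> ` L) y"
    if L: "L \<in> path_matchings q i R Q" for L
  proof -
    have "L \<subseteq> path_edges q i" using L by (simp add: partial_matchings_def)
    then have LP: "\<Union>L \<subseteq> set q" using q.path_edges_subset(1) by blast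
    have U: "\<Union>(image \<phi> ` L) = \<phi> ` \<Union>L" by blast
    have LR: "\<Union>L \<union> R \<subseteq> set q" using LP sub by simp
    have mem: "p ! j \<in> \<phi> ` A \<longleftrightarrow> q ! j \<in> A" if "j < m" "A \<subseteq> set q" for j A
    proof -
      have "q ! j \<in> set q" "p ! j = \<phi> (q ! j)"
        using that(1) len nth_map[of j q \<phi>] pq by simp_all
      then show ?thesis using inj_on_image_mem_iff[OF inj _ that(2)] by simp
    qed
    have lt: "i < m" "i + 1 < m" "i + 2 < m" "(i + 3) mod m < m"
      using i_le p_nonempty by (auto simp: m_def)
    show ?thesis
      unfolding slot_test_def U image_Un[symmetric] len m_def[symmetric]
        mem[OF lt(1) LR] mem[OF lt(2) LP] mem[OF lt(3) LP] mem[OF lt(4) LR] ..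
  qed
  have "T_mat m i $$ (x, y) = card {L \<in> path_matchings q i R Q. slot_test q i R L y}"
    using T_mat_entry[of i m x y] i_pos i_le assms by (simp add: q_def R_def Q_def m_def)
  also have "\<dots> = card {L \<in> path_matchings p i (\<phi> ` R) (\<phi> ` Q). slot_test p i (\<phi> ` R) L y}"
    by (rule card_filter_bij[OF bij]) (rule test)
  finally show ?thesis unfolding RQ m_def .
qed

text \<open>The edge \<open>dc\<close> is counted as part of \<open>H\<close>, so only the path cut
  open there remains of the polygon, and \<open>slot_count\<close> applies.\<close>

lemma row_count_transfer:
  assumes "{} \<notin> H" "\<Union>H \<inter> set p \<subseteq> {d, c}" "{d, c} \<in> H" "finite H" "x < 9"
  shows "row_count (cyc_edges p \<union> H) (p ! 1) (p ! 0) x =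
    (\<Sum>y<9. T_mat (length p) i $$ (x, y) * row_count H d c y)"
proof -
  have "cyc_edge p (i + 1) = {d, c}" using i_le by (simp add: cyc_edge_def)
  moreover have "cyc_edges p = path_edges p i \<union> {cyc_edge p (i + 1)}"
    unfolding cyc_edges_def path_edges_def using i_le by auto
  ultimately have *: "cyc_edges p \<union> H = path_edges p i \<union> H" using assms(3) by auto
  have "p ! 1 \<in> set p" "p ! 0 \<in> set p" using i_le p_nonempty by (auto intro!: nth_mem)
  then have "{p ! 1, p ! 0} \<subseteq> set p - {d, c}" using ends_not_slot by simp
  then have sub: "rows_removed (p ! 1) (p ! 0) x \<subseteq> set p - {d, c}" "rows_required (p ! 1) (p ! 0) x \<subseteq> set p - {d, c}"
    using rows_subset[OF assms(5), of "p ! 1" "p ! 0"] by (meson order_trans)+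
  show ?thesis
    unfolding * row_count_def[of "path_edges p i \<union> H"] slot_count[OF assms(1,2) sub assms(4)]
    by (rule sum.cong) (simp_all add: T_mat_entry_polygon[OF assms(5)])
qed

end

text \<open>The vector of a single edge, which is \<open>Y\<close>. The zeros belong to the rows in
  which one end is removed and the other one required.\<close>

lemma row_count_edge:
  assumes "d \<noteq> c" "y < 9"
  shows "row_count {{d, c}} d c y = [1, 1, 1, 1, 1, 0, 0, 1, 1] ! y"
proof -
  have ne: "{} \<notin> {{d, c}}" by simp
  have M: "M \<in> constrained_matchings {{d, c}} S Q \<longleftrightarrow>
      M = (if S \<inter> {d, c} = {} then {{d, c}} else {}) \<and> Q \<subseteq> \<Union>M" for M S Q
    unfolding constrained_matchings_iff[OF ne] subset_singleton_iff by auto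
  have cm: "constrained_matchings {{d, c}} S Q = (if Q \<subseteq> \<Union>N then {N} else {})"
    if "N = (if S \<inter> {d, c} = {} then {{d, c}} else {})" for S Q N
    using M[of _ S Q] that by auto
  show ?thesis
    unfolding row_count_def cm[OF refl] using assms(2)
    by (cases rule: less_9_cases) (use assms(1) in \<open>simp_all add: rows_removed_def rows_required_def\<close>)
qed

section \<open>Recursion along the chain\<close>

lemma cyc_edge_rotate:
  assumes "j < length p"
  shows "cyc_edge (rotate \<alpha> p) j = cyc_edge p ((\<alpha> + j) mod length p)"
proof -
  have "Suc j mod length p < length p" using assms by (intro mod_less_divisor) auto
  then show ?thesis using assms by (simp add: cyc_edge_def nth_rotate mod_simps)
qed

lemma cyc_edges_rotate: "cyc_edges (rotate \<alpha> p) = cyc_edges p"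
proof (cases "p = []")
  case False
  have "cyc_edges (rotate \<alpha> p) = (\<lambda>j. cyc_edge p ((\<alpha> + j) mod length p)) ` {..<length p}"
    unfolding cyc_edges_def by (auto simp: cyc_edge_rotate)
  also have "\<dots> = cyc_edge p ` ((\<lambda>j. (\<alpha> + j) mod length p) ` {..<length p})"
    by (simp add: image_image)
  also have "(\<lambda>j. (\<alpha> + j) mod length p) ` {..<length p} = {..<length p}"
  proof
    show "{..<length p} \<subseteq> (\<lambda>j. (\<alpha> + j) mod length p) ` {..<length p}"
    proof
      fix k assume k: "k \<in> {..<length p}"
      \<comment> \<open>\<open>j\<close> is \<open>k\<close> shifted back by
        \<open>\<alpha>\<close>, written so that no subtraction is truncated.\<close>
      define j where "j = (k + (length p - \<alpha> mod length p)) mod length p"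
      have "(\<alpha> + j) mod length p = (\<alpha> mod length p + (k + (length p - \<alpha> mod length p))) mod length p"
        unfolding j_def by (simp add: mod_simps)
      also have "\<alpha> mod length p + (k + (length p - \<alpha> mod length p)) = k + length p"
        using False mod_less_divisor[of "length p" \<alpha>] by (metis add.commute add.left_commute
            le_add_diff_inverse2 length_greater_0_conv less_imp_le)
      also have "(k + length p) mod length p = k" using k by simp
      finally show "k \<in> (\<lambda>j. (\<alpha> + j) mod length p) ` {..<length p}"
        using False by (intro image_eqI[of _ _ j]) (auto simp: j_def)
    qed
  qed (use False in auto)
  finally show ?thesis unfolding cyc_edges_def .
qed (simp add: cyc_edges_def)

text \<open>Different positions carry different edges, so the definite description asks for the
  residue of \<open>\<beta> - \<alpha> - 1\<close> modulo the length, which exists and is unique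
  below the length.\<close>

lemma edges_between_eq:
  assumes "distinct p" "3 \<le> length p" "\<alpha> < length p" "\<beta> < length p"
  shows "(\<alpha> + edges_between p (cyc_edge p \<alpha>) (cyc_edge p \<beta>) + 1) mod length p = \<beta>"
proof -
  let ?P = "\<lambda>k. k < length p \<and> (\<exists>a<length p. cyc_edge p a = cyc_edge p \<alpha> \<and>
    cyc_edge p ((a + k + 1) mod length p) = cyc_edge p \<beta>)"
  have P: "?P k \<longleftrightarrow> k < length p \<and> (\<alpha> + k + 1) mod length p = \<beta>" for k
  proof -
    have "(\<alpha> + k + 1) mod length p < length p" using assms(3) by (intro mod_less_divisor) linarith
    then show ?thesis
      using cyc_edge_inj[OF assms(1,2) _ assms(3)] cyc_edge_inj[OF assms(1,2) _ assms(4)] assms(3) by metis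
  qed
  define k where "k = (\<beta> + (length p - 1 - \<alpha>)) mod length p"
  have "(\<alpha> + k + 1) mod length p = (\<alpha> + (\<beta> + (length p - 1 - \<alpha>)) + 1) mod length p"
    unfolding k_def by (metis mod_add_left_eq mod_add_right_eq)
  also have "\<alpha> + (\<beta> + (length p - 1 - \<alpha>)) + 1 = \<beta> + length p" using assms(3) by simp
  also have "(\<beta> + length p) mod length p = \<beta>" using assms(4) by simp
  finally have k: "(\<alpha> + k + 1) mod length p = \<beta>" .
  have k_less: "k < length p" unfolding k_def using assms(3) by (intro mod_less_divisor) linarith
  then have "?P k" unfolding P using k by simp
  moreover have "l = k" if "?P l" for l
  proof -
    have kl: "k < length p" "l < length p" and eq: "(\<alpha> + 1 + l) mod length p = (\<alpha> + 1 + k) mod length p"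
      using that k k_less unfolding P by (simp_all add: add_ac)
    have "[\<alpha> + 1 + l = \<alpha> + 1 + k] (mod length p)" using eq by (simp add: unique_euclidean_semiring_class.cong_def)
    then have "[l = k] (mod length p)" by (simp only: cong_add_lcancel_nat)
    then show ?thesis using kl by (simp add: unique_euclidean_semiring_class.cong_def)
  qed
  ultimately have "edges_between p (cyc_edge p \<alpha>) (cyc_edge p \<beta>) = k"
    unfolding edges_between_def by (rule the_equality)
  then show ?thesis using k by simp
qed

lemma steps_closed_iff:
  assumes "p \<noteq> []"
  shows "(u, v) \<in> set (steps (p @ [hd p])) \<longleftrightarrow> (\<exists>a<length p. u = p ! a \<and> v = p ! (Suc a mod length p))"
  unfolding steps_closed[OF assms] by auto

section \<open>Entry edges and counts for the tails of the chain\<close>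

context drawn_chain
begin

text \<open>The edge through which face \<open>j\<close> is entered from face \<open>j - 1\<close> is oriented \<open>b \<rightarrow> a\<close> in the clockwise order of
  the entered face, hence \<open>a = d \<rightarrow> c = b\<close> in the face that is left.\<close>

definition entry :: "nat \<Rightarrow> nat" where
  "entry j = (SOME a. a < length (ps ! j) \<and> cyc_edge (ps ! j) a \<in> cyc_edges (ps ! (j - 1)))"

definition entry_b :: "nat \<Rightarrow> complex" where
  "entry_b j = ps ! j ! entry j"

definition entry_a :: "nat \<Rightarrow> complex" where
  "entry_a j = ps ! j ! (Suc (entry j) mod length (ps ! j))"

definition tail_edges :: "nat \<Rightarrow> complex set set" where
  "tail_edges j = (\<Union>k \<in> {j..<length ps}. cyc_edges (ps ! k))"

lemma entry:
  assumes "Suc j < length ps"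
  shows "entry (Suc j) < length (ps ! Suc j)"
    "cyc_edge (ps ! Suc j) (entry (Suc j)) = {entry_b (Suc j), entry_a (Suc j)}"
    "cyc_edges (ps ! j) \<inter> cyc_edges (ps ! Suc j) = {{entry_b (Suc j), entry_a (Suc j)}}"
    "shared_edge (ps ! j) (ps ! Suc j) = {entry_b (Suc j), entry_a (Suc j)}"
proof -
  obtain s where s: "cyc_edges (ps ! j) \<inter> cyc_edges (ps ! Suc j) = {s}"
    using adjacent assms card_1_singletonE by metis
  then have "s \<in> cyc_edges (ps ! j)" "s \<in> cyc_edges (ps ! Suc j)" by blast+
  then have "\<exists>a. a < length (ps ! Suc j) \<and> cyc_edge (ps ! Suc j) a \<in> cyc_edges (ps ! (Suc j - 1))"
    unfolding cyc_edges_def[of "ps ! Suc j"] by auto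
  then have e: "entry (Suc j) < length (ps ! Suc j) \<and>
      cyc_edge (ps ! Suc j) (entry (Suc j)) \<in> cyc_edges (ps ! (Suc j - 1))"
    unfolding entry_def by (rule someI_ex)
  then show "entry (Suc j) < length (ps ! Suc j)" by blast
  have "cyc_edge (ps ! Suc j) (entry (Suc j)) \<in> cyc_edges (ps ! j) \<inter> cyc_edges (ps ! Suc j)"
    using e by (simp add: cyc_edges_def[of "ps ! Suc j"])
  moreover show c: "cyc_edge (ps ! Suc j) (entry (Suc j)) = {entry_b (Suc j), entry_a (Suc j)}"
    by (simp add: cyc_edge_def entry_b_def entry_a_def)
  ultimately show *: "cyc_edges (ps ! j) \<inter> cyc_edges (ps ! Suc j) = {{entry_b (Suc j), entry_a (Suc j)}}"
    unfolding s by simp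
  show "shared_edge (ps ! j) (ps ! Suc j) = {entry_b (Suc j), entry_a (Suc j)}"
    unfolding shared_edge_def * by simp
qed

text \<open>By \<open>opposite_orientation\<close> the common edge runs from \<open>a\<close> to
  \<open>b\<close> in face \<open>j\<close>. This decides which of its ends takes the place of
  \<open>d\<close> and which that of \<open>c\<close>.\<close>

lemma exit_index:
  assumes "Suc j < length ps"
  obtains \<beta> where "\<beta> < length (ps ! j)" "ps ! j ! \<beta> = entry_a (Suc j)"
    "ps ! j ! (Suc \<beta> mod length (ps ! j)) = entry_b (Suc j)"
proof -
  have j: "j < length ps" using assms by simp
  have "(entry_b (Suc j), entry_a (Suc j)) \<in> set (steps (closed_face (Suc j)))"
    unfolding steps_closed_iff[OF face(4)[OF assms]] entry_b_def entry_a_def using entry(1)[OF assms] by blast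
  then have "(entry_b (Suc j), entry_a (Suc j)) \<notin> set (steps (closed_face j))"
    using opposite_orientation[OF assms j] by simp
  moreover have "{entry_b (Suc j), entry_a (Suc j)} \<in> cyc_edges (ps ! j)"
    using entry(3)[OF assms] by blast
  ultimately have "(entry_a (Suc j), entry_b (Suc j)) \<in> set (steps (closed_face j))"
    using cyc_edges_face[OF j] by blast
  then show ?thesis
    unfolding steps_closed_iff[OF face(4)[OF j]] using that by auto
qed

text \<open>A vertex common to face \<open>j\<close> and a later face lies on a common edge, and
  only the face right after \<open>j\<close> has one.\<close>

lemma tail_meets:
  assumes "Suc j < length ps"
  shows "\<Union>(tail_edges (Suc j)) \<inter> set (ps ! j) \<subseteq> {entry_a (Suc j), entry_b (Suc j)}"
proof
  fix v assume v: "v \<in> \<Union>(tail_edges (Suc j)) \<inter> set (ps ! j)"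
  then obtain k x where k: "Suc j \<le> k" "k < length ps" "x \<in> cyc_edges (ps ! k)" "v \<in> x"
    unfolding tail_edges_def by auto
  then have "v \<in> set (ps ! k)" using cyc_edges_subset by blast
  then obtain e where e: "e \<in> cyc_edges (ps ! j) \<inter> cyc_edges (ps ! k)" "v \<in> e"
    using common_vertex_on_shared_edge[of j k v] k v by auto
  then have "k = Suc j" using nonadjacent k(1,2) by (metis empty_iff le_neq_implies_less)
  then have "e \<in> {{entry_b (Suc j), entry_a (Suc j)}}" using e(1) entry(3)[OF assms] by simp
  then show "v \<in> {entry_a (Suc j), entry_b (Suc j)}" using e(2) by auto
qed

lemma tail_edges_Suc: "j < length ps \<Longrightarrow> tail_edges j = cyc_edges (ps ! j) \<union> tail_edges (Suc j)"
proof -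
  assume "j < length ps"
  then have "{j..<length ps} = insert j {Suc j..<length ps}" by auto
  then show ?thesis by (simp add: tail_edges_def)
qed

lemma tail_edges_nonempty: "{} \<notin> tail_edges j" and finite_tail_edges: "finite (tail_edges j)"
  unfolding tail_edges_def by (auto simp: cyc_edges_def cyc_edge_def)

text \<open>Rotating the face by \<open>\<alpha>\<close> puts the entry edge at position 0 and the
  exit edge at \<open>i + 1\<close>. The offset is left open because the first face has no entry
  edge of its own.\<close>

lemma transfer_step:
  assumes "Suc j < length ps" "1 \<le> i" "i + 3 \<le> length (ps ! j)" "x < 9"
    and "ps ! j ! ((\<alpha> + i + 1) mod length (ps ! j)) = entry_a (Suc j)"
    and "ps ! j ! ((\<alpha> + i + 2) mod length (ps ! j)) = entry_b (Suc j)"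
  shows "row_count (tail_edges j) (ps ! j ! ((\<alpha> + 1) mod length (ps ! j))) (ps ! j ! (\<alpha> mod length (ps ! j))) x =
    (\<Sum>y<9. T_mat (length (ps ! j)) i $$ (x, y) *
       row_count (tail_edges (Suc j)) (entry_a (Suc j)) (entry_b (Suc j)) y)"
proof -
  have j: "j < length ps" using assms by simp
  define p where "p = rotate \<alpha> (ps ! j)"
  have len: "length p = length (ps ! j)" by (simp add: p_def)
  have nth: "p ! k = ps ! j ! ((\<alpha> + k) mod length (ps ! j))" if "k < length (ps ! j)" for k
    using that by (simp add: p_def nth_rotate)
  interpret polygon_slot p i
    using face(1)[OF j] assms(2,3) by unfold_locales (simp_all add: p_def)
  have dc: "p ! (i + 1) = entry_a (Suc j)" "p ! (i + 2) = entry_b (Suc j)"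
    using nth[of "i + 1"] nth[of "i + 2"] assms(3,5,6) by (simp_all add: add.assoc)
  have ba: "p ! 0 = ps ! j ! (\<alpha> mod length (ps ! j))" "p ! 1 = ps ! j ! ((\<alpha> + 1) mod length (ps ! j))"
    using nth[of 0] nth[of 1] face(2,4)[OF j] by auto
  have "{entry_a (Suc j), entry_b (Suc j)} \<in> cyc_edges (ps ! Suc j)"
    using entry(3)[OF assms(1)] by (metis IntD2 insertI1 insert_commute)
  then have "{p ! (i + 1), p ! (i + 2)} \<in> tail_edges (Suc j)"
    unfolding dc tail_edges_def using assms(1) by force
  moreover have "\<Union>(tail_edges (Suc j)) \<inter> set p \<subseteq> {p ! (i + 1), p ! (i + 2)}"
    unfolding dc using tail_meets[OF assms(1)] by (simp add: p_def)
  ultimately have "row_count (cyc_edges p \<union> tail_edges (Suc j)) (p ! 1) (p ! 0) x =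
      (\<Sum>y<9. T_mat (length p) i $$ (x, y) * row_count (tail_edges (Suc j)) (p ! (i + 1)) (p ! (i + 2)) y)"
    using row_count_transfer[OF tail_edges_nonempty _ _ finite_tail_edges assms(4)] by blast
  moreover have "cyc_edges p = cyc_edges (ps ! j)" by (simp add: p_def cyc_edges_rotate)
  ultimately show ?thesis by (simp only: tail_edges_Suc[OF j] ba dc len)
qed

definition tail_count :: "nat \<Rightarrow> nat \<Rightarrow> nat" where
  "tail_count j x = row_count (tail_edges j) (entry_a j) (entry_b j) x"

lemma tail_count_internal:
  assumes "Suc (Suc j) < length ps" "x < 9"
    and "k = edges_between (ps ! Suc j) (shared_edge (ps ! j) (ps ! Suc j)) (shared_edge (ps ! Suc j) (ps ! Suc (Suc j)))"
    and "1 \<le> k" "k + 3 \<le> length (ps ! Suc j)"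
  shows "tail_count (Suc j) x = (\<Sum>y<9. T_mat (length (ps ! Suc j)) k $$ (x, y) * tail_count (Suc (Suc j)) y)"
proof -
  let ?p = "ps ! Suc j"
  let ?l = "length ?p"
  have j: "Suc j < length ps" using assms(1) by simp
  obtain \<beta> where \<beta>: "\<beta> < ?l" "?p ! \<beta> = entry_a (Suc (Suc j))" "?p ! (Suc \<beta> mod ?l) = entry_b (Suc (Suc j))"
    using exit_index[OF assms(1)] .
  have "cyc_edge ?p \<beta> = shared_edge ?p (ps ! Suc (Suc j))"
    unfolding entry(4)[OF assms(1)] cyc_edge_def \<beta> by (rule insert_commute)
  \<comment> \<open>With \<open>k\<close> edges strictly in between, the exit edge comes
    \<open>k + 1\<close> positions after the entry edge, so \<open>k\<close> is the index of the
    transfer matrix.\<close>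
  then have k: "(entry (Suc j) + k + 1) mod ?l = \<beta>"
    using edges_between_eq[OF face(1,3)[OF j] entry(1)[OF j] \<beta>(1)]
    unfolding assms(3) entry(2,4)[OF j] by simp
  have "(entry (Suc j) + k + 2) mod ?l = Suc \<beta> mod ?l"
    unfolding k[symmetric] by (simp add: mod_simps)
  then show ?thesis
    using transfer_step[OF assms(1,4,5,2), of "entry (Suc j)"] \<beta> k entry(1)[OF j]
    by (simp add: tail_count_def entry_a_def[of "Suc j"] entry_b_def[of "Suc j"])
qed

text \<open>The last face has no exit, so its edge at position 2 is used as one. What lies behind it
  is that edge alone, whose vector is \<open>Y\<close>.\<close>

lemma tail_count_last:
  assumes "length ps = Suc (Suc j)" "x < 9"
  shows "tail_count (Suc j) x = (\<Sum>y<9. T_mat (length (ps ! Suc j)) 1 $$ (x, y) * [1, 1, 1, 1, 1, 0, 0, 1, 1] ! y)"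
proof -
  have j: "Suc j < length ps" using assms by simp
  define p where "p = rotate (entry (Suc j)) (ps ! Suc j)"
  interpret polygon_slot p 1
    using face(1,2)[OF j] by unfold_locales (simp_all add: p_def)
  have "p ! 0 = entry_b (Suc j)" "p ! 1 = entry_a (Suc j)"
    using entry(1)[OF j] face(2,4)[OF j] by (simp_all add: p_def nth_rotate entry_a_def entry_b_def)
  moreover have "tail_edges (Suc j) = cyc_edges p \<union> {{p ! (1 + 1), p ! (1 + 2)}}"
  proof -
    have "{p ! 2, p ! 3} = cyc_edge p 2" using i_le by (simp add: cyc_edge_def numeral_3_eq_3)
    then have "{p ! 2, p ! 3} \<in> cyc_edges p" using i_le by (simp add: cyc_edges_def)
    moreover have "tail_edges (Suc j) = cyc_edges (ps ! Suc j)" by (simp add: tail_edges_def assms)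
    moreover have "cyc_edges p = cyc_edges (ps ! Suc j)" by (simp add: p_def cyc_edges_rotate)
    ultimately show ?thesis by (simp add: insert_absorb numeral_2_eq_2 numeral_3_eq_3)
  qed
  ultimately have "tail_count (Suc j) x = (\<Sum>y<9. T_mat (length p) 1 $$ (x, y) *
      row_count {{p ! (1 + 1), p ! (1 + 2)}} (p ! (1 + 1)) (p ! (1 + 2)) y)"
    using row_count_transfer[of "{{p ! (1 + 1), p ! (1 + 2)}}" x] assms(2) by (simp add: tail_count_def)
  also have "\<dots> = (\<Sum>y<9. T_mat (length p) 1 $$ (x, y) * [1, 1, 1, 1, 1, 0, 0, 1, 1] ! y)"
    by (rule sum.cong[OF refl]) (simp only: row_count_edge[OF distinct_vertices(5)] lessThan_iff)
  finally show ?thesis by (simp add: p_def)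
qed

lemma num_maximal_matchings_first:
  "num_maximal_matchings E = (\<Sum>y<9. T_mat (length (ps ! 0)) 1 $$ (0, y) * tail_count 1 y)"
proof -
  have j: "Suc 0 < length ps" using chain_facts(1) by simp
  have j0: "0 < length ps" using chain_facts(1) by linarith
  let ?p = "ps ! 0"
  let ?l = "length ?p"
  obtain \<beta> where \<beta>: "\<beta> < ?l" "?p ! \<beta> = entry_a (Suc 0)" "?p ! (Suc \<beta> mod ?l) = entry_b (Suc 0)"
    using exit_index[OF j] .
  \<comment> \<open>The entry edge is chosen two positions before the exit edge, which gives the
    matrix index 1. Adding the length avoids a truncated subtraction.\<close>
  define \<alpha> where "\<alpha> = \<beta> + ?l - 2"
  have l: "4 \<le> ?l" using face(2)[OF j0] .
  have a: "(\<alpha> + 1 + 1) mod ?l = \<beta>" "(\<alpha> + 1 + 2) mod ?l = Suc \<beta> mod ?l"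
  proof -
    have "\<alpha> + 1 + 1 = \<beta> + ?l" "\<alpha> + 1 + 2 = Suc \<beta> + ?l" using l by (auto simp: \<alpha>_def)
    then show "(\<alpha> + 1 + 1) mod ?l = \<beta>" "(\<alpha> + 1 + 2) mod ?l = Suc \<beta> mod ?l"
      using \<beta>(1) by (simp_all only: mod_add_self2 mod_less)
  qed
  have "set ps = (!) ps ` {0..<length ps}" by (auto simp: set_conv_nth)
  then have "tail_edges 0 = E" unfolding tail_edges_def by (subst E_eq) simp
  \<comment> \<open>Row 0 imposes nothing on the entry vertices, so any two vertices may be named
    here.\<close>
  then have "num_maximal_matchings E = row_count (tail_edges 0) v w 0" for v w
    by (simp add: num_maximal_matchings_def row_count_def constrained_matchings_def
        rows_removed_def rows_required_def delete_vertices_def)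
  also have "row_count (tail_edges 0) (?p ! ((\<alpha> + 1) mod ?l)) (?p ! (\<alpha> mod ?l)) 0 =
      (\<Sum>y<9. T_mat ?l 1 $$ (0, y) * row_count (tail_edges (Suc 0)) (entry_a (Suc 0)) (entry_b (Suc 0)) y)"
    by (rule transfer_step[OF j]) (use l a \<beta> in simp_all)
  finally show ?thesis by (simp add: tail_count_def)
qed

end

section \<open>Passing from sums over states to the matrix product\<close>

lemma foldr_mult_mat:
  fixes c :: "nat mat"
  assumes "set As \<subseteq> carrier_mat k k" "c \<in> carrier_mat k l"
  shows "foldr (*) As (1\<^sub>m k) \<in> carrier_mat k k \<and> foldr (*) As (1\<^sub>m k) * c = foldr (*) As c"
  using assms
proof (induction As)
  case (Cons A As)
  then show ?case
    using assoc_mult_mat[of A k k "foldr (*) As (1\<^sub>m k)" k c l] by auto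
qed auto

definition column_mat :: "(nat \<Rightarrow> nat) \<Rightarrow> nat mat" where
  "column_mat v = Matrix.mat 9 1 (\<lambda>(x, _). v x)"

lemma T_mat_carrier: "T_mat m i \<in> carrier_mat 9 9"
  by (simp add: T_mat_def)

lemma column_mat_carrier: "column_mat v \<in> carrier_mat 9 1"
  by (simp add: column_mat_def)

lemma mult_column_mat:
  assumes "A \<in> carrier_mat 9 9" "\<And>x. x < 9 \<Longrightarrow> w x = (\<Sum>y<9. A $$ (x, y) * v y)"
  shows "A * column_mat v = column_mat w"
proof (rule eq_matI)
  fix x z assume "x < dim_row (column_mat w)" "z < dim_col (column_mat w)"
  then show "(A * column_mat v) $$ (x, z) = column_mat w $$ (x, z)"
    using assms by (simp add: column_mat_def scalar_prod_def lessThan_atLeast0)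
qed (use assms in \<open>simp_all add: column_mat_def\<close>)

lemma Y_mat_eq: "Y_mat = column_mat (nth [1, 1, 1, 1, 1, 0, 0, 1, 1])"
  by (rule eq_matI) (simp_all add: Y_mat_def column_mat_def mat_of_rows_list_def)

lemma X_mat_column: "(X_mat * column_mat v) $$ (0, 0) = v 0"
  by (simp add: X_mat_def column_mat_def mat_of_rows_list_def scalar_prod_def numeral_eq_Suc)

theorem theorem5:
  fixes V :: "complex set" and E :: "complex set set"
    and \<gamma> :: "complex \<Rightarrow> complex \<Rightarrow> real \<Rightarrow> complex"
    and ps :: "complex list list"
    and n :: nat and s :: "nat \<Rightarrow> nat" and M :: "nat \<Rightarrow> polygon_type"
  assumes "polygon_chain V E \<gamma> ps" and "length ps = n"
    and "chain_type ps = Terminal (s 1) # map M [2..<n] @ [Terminal (s n)]"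
    and "\<forall>i \<in> {2..n - 1}. M i \<in> {Internal (s i) k | k. k \<in> {1..s i - 3}}"
  shows "num_maximal_matchings E =
    (X_mat * T_mat (s 1) 1 * mat9_prod_list (map (\<lambda>i. f_mat (M i)) [2..<n])
       * T_mat (s n) 1 * Y_mat) $$ (0, 0)"
proof -
  interpret drawn_chain V E \<gamma> ps by unfold_locales (rule assms(1))
  have n: "2 \<le> n" using chain_facts(1) assms(2) by simp
  have type_nth: "chain_type ps ! j = (Terminal (s 1) # map M [2..<n] @ [Terminal (s n)]) ! j" for j
    using assms(3) by simp
  have type_def: "chain_type ps ! j = (if j = 0 \<or> Suc j = n then Terminal (length (ps ! j))
     else Internal (length (ps ! j))
       (edges_between (ps ! j)
         (shared_edge (ps ! (j - 1)) (ps ! j)) (shared_edge (ps ! j) (ps ! Suc j))))" if "j < n" for j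
    using that assms(2) by (simp add: chain_type_def)
  have s1: "s 1 = length (ps ! 0)"
    using type_nth[of 0] type_def[of 0] n by simp
  have sn: "s n = length (ps ! (n - 1))"
    using type_nth[of "n - 1"] type_def[of "n - 1"] n by (simp add: nth_Cons' nth_append numeral_2_eq_2)
  \<comment> \<open>\<open>M\<close> is numbered from 1 and \<open>ps\<close> from 0, so
    \<open>M (Suc (Suc j))\<close> describes the face \<open>ps ! Suc j\<close>.\<close>
  have internal: "f_mat (M (Suc (Suc j))) * column_mat (tail_count (Suc (Suc j))) = column_mat (tail_count (Suc j)) \<and>
      f_mat (M (Suc (Suc j))) \<in> carrier_mat 9 9"
    if j: "Suc (Suc j) < n" for j
  proof -
    define k where "k = edges_between (ps ! Suc j) (shared_edge (ps ! j) (ps ! Suc j))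
       (shared_edge (ps ! Suc j) (ps ! Suc (Suc j)))"
    have "j < n - 2" using j by linarith
    then have M: "M (Suc (Suc j)) = Internal (length (ps ! Suc j)) k"
      using type_nth[of "Suc j"] type_def[of "Suc j"] j
      by (simp add: nth_append k_def)
    obtain k' where "M (Suc (Suc j)) = Internal (s (Suc (Suc j))) k'" "k' \<in> {1..s (Suc (Suc j)) - 3}"
      using assms(4) j by force
    then have k: "1 \<le> k" "k \<le> length (ps ! Suc j) - 3" using M by auto
    \<comment> \<open>As \<open>k\<close> is positive, the truncated difference in its upper bound
      is a true one.\<close>
    then have k3: "k + 3 \<le> length (ps ! Suc j)" by linarith
    show ?thesis
      unfolding M f_mat.simps
      using tail_count_internal[OF _ _ k_def k(1) k3] j assms(2) T_mat_carrier
      by (auto intro!: mult_column_mat)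
  qed
  define As where "As = map (\<lambda>i. f_mat (M i)) [2..<n]"
  have last: "T_mat (s n) 1 * Y_mat = column_mat (tail_count (n - 1))"
  proof -
    have "n = Suc (Suc (n - 2))" "n - 1 = Suc (n - 2)" using n by auto
    then show ?thesis
      unfolding Y_mat_eq sn using tail_count_last[of "n - 2"] assms(2)
      by (intro mult_column_mat T_mat_carrier) auto
  qed
  \<comment> \<open>The factors are absorbed from the right: each one turns the column of the tail
    behind its face into that of the tail starting with it.\<close>
  have "foldr (*) (map (\<lambda>i. f_mat (M i)) [i..<n]) (column_mat (tail_count (n - 1))) = column_mat (tail_count (i - 1))"
    if "2 \<le> i" "i \<le> n" for i
    using that(2,1)
  proof (induction rule: inc_induct)
    case (step i)
    then show ?case
      using internal[of "i - 2"] by (simp add: upt_conv_Cons Suc_diff_Suc numeral_2_eq_2 Suc_diff_le)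
  qed simp
  from this[of 2] n have mid: "foldr (*) As (column_mat (tail_count (n - 1))) = column_mat (tail_count 1)"
    by (simp add: As_def)
  have "f_mat (M i) \<in> carrier_mat 9 9" if "2 \<le> i" "i < n" for i
    using internal[of "i - 2"] that by (simp add: Suc_diff_Suc numeral_2_eq_2)
  then have As: "set As \<subseteq> carrier_mat 9 9" by (auto simp: As_def)
  note prod = foldr_mult_mat[OF As column_mat_carrier]
  have P: "mat9_prod_list As \<in> carrier_mat 9 9"
    "mat9_prod_list As * column_mat v = foldr (*) As (column_mat v)" for v
    unfolding mat9_prod_list_def using prod by blast+
  define C0 where "C0 = (\<lambda>x. \<Sum>y<9. T_mat (s 1) 1 $$ (x, y) * tail_count 1 y)"
  have X: "X_mat \<in> carrier_mat 1 9" by (simp add: X_mat_def mat_of_rows_list_def)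
  have Y: "Y_mat \<in> carrier_mat 9 1" unfolding Y_mat_eq by (rule column_mat_carrier)
  have XT: "X_mat * T_mat (s 1) 1 \<in> carrier_mat 1 9" using X T_mat_carrier by (rule mult_carrier_mat)
  have "X_mat * T_mat (s 1) 1 * mat9_prod_list As * T_mat (s n) 1 * Y_mat =
      X_mat * T_mat (s 1) 1 * mat9_prod_list As * column_mat (tail_count (n - 1))"
    unfolding last[symmetric]
    by (rule assoc_mult_mat[OF mult_carrier_mat[OF XT P(1)] T_mat_carrier Y])
  also have "\<dots> = X_mat * T_mat (s 1) 1 * column_mat (tail_count 1)"
    unfolding mid[symmetric] P(2)[symmetric]
    by (rule assoc_mult_mat[OF XT P(1) column_mat_carrier])
  also have "\<dots> = X_mat * (T_mat (s 1) 1 * column_mat (tail_count 1))"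
    by (rule assoc_mult_mat[OF X T_mat_carrier column_mat_carrier])
  also have "T_mat (s 1) 1 * column_mat (tail_count 1) = column_mat C0"
    by (rule mult_column_mat[OF T_mat_carrier]) (simp add: C0_def)
  \<comment> \<open>\<open>X_mat\<close> selects entry 0, the row without constraints, which counts
    all maximal matchings.\<close>
  finally show ?thesis
    using num_maximal_matchings_first[folded s1] by (simp add: As_def X_mat_column C0_def)
qed

end
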